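(* Let $1\le m\le k\le n-m$. The kernel of the linear mapping $f\mapsto F_{m,k}f$, acting on $L^1(V_{n,m})$, is $$\ker F_{m,k}=\Big\{f\in L^1(V_{n,m}):\ \int_{O(m)} f(v\gamma)\,d\gamma=0\ \text{ for almost every } v\in V_{n,m}\Big\}.$$
   Context: $V_{n,m}=\{v\in M_{n,m}(\mathbb R): v'v=I_m\}$ is the Stiefel manifold of orthonormal $m$-frames in $\mathbb R^n$ ($v'$ is the transpose), equipped with the $O(n)$-invariant probability measure $d_*v$; $L^1(V_{n,m})$ is taken with respect to this measure. $O(m)$ carries the normalized Haar measure $d\gamma$ (total mass 1). For $k+m\le n$ the (higher-rank) Funk transform sends a function $f$ on $V_{n,m}$ to the function on $V_{n,k}$ $$(F_{m,k}f)(u)=\int_{V_{n-k,m}} f\Big(g_u\begin{bmatrix}\omega\\0\end{bmatrix}\Big)\,d_*\omega,\qquad u\in V_{n,k},$$ where $g_u\in O(n)$ is any orthogonal matrix with $g_u\begin{bmatrix}0\\ I_k\end{bmatrix}=u$ (i.e. $f$ is averaged over all $v\in V_{n,m}$ with $u'v=0$). For $f\in L^1(V_{n,m})$ it is defined for almost all $u$; functions are identified when equal almost everywhere. *)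

theory Defs
  imports "HOL-Probability.Probability"
begin

text \<open>
  The type \<^typ>\<open>real^'m^'n\<close> is the type of real matrices with rows indexed by \<open>'n\<close> and columns
  indexed by \<open>'m\<close>.
\<close>

definition stiefel :: "(real^'m^'n) set" where
  "stiefel = {v. transpose v ** v = mat 1}"

text \<open>
  By transitivity of the action of the orthogonal group there is exactly one such \<open>M\<close> when
  \<open>S\<close> is a nonempty Stiefel manifold.  For \<open>S = {\<gamma>. orthogonal_matrix \<gamma>}\<close> it is the normalized Haar
  measure of the orthogonal group (which is compact, so left and right invariance agree).
\<close>

definition invariant_prob :: "(real^'m^'n) set \<Rightarrow> (real^'m^'n) measure \<Rightarrow> bool" where
  "invariant_prob S M \<longleftrightarrow>
     prob_space M \<and> sets M = sets (restrict_space borel S) \<and>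
     (\<forall>g. orthogonal_matrix g \<longrightarrow> distr M M (\<lambda>v. g ** v) = M)"

definition vblock :: "'a^'m^'l \<Rightarrow> 'a^'m^'k \<Rightarrow> 'a^'m^('l::finite + 'k::finite)" where
  "vblock A B = (\<chi> i. case i of Inl a \<Rightarrow> A $ a | Inr b \<Rightarrow> B $ b)"

text \<open>
  With \<open>n = CARD('l) + CARD('k)\<close>, the last \<open>k\<close> row indices form the right summand of \<open>'l + 'k\<close>, and
  \<open>'l\<close> is the index type of size \<open>n - k\<close>.  If \<open>\<nu>\<close> is the invariant probability measure on the
  Stiefel manifold of \<open>m\<close>-frames in dimension \<open>n - k\<close>, the value of \<open>funk\<close> below does not depend
  on the choice of the orthogonal matrix.
\<close>

definition frame_completion :: "real^'k^('l::finite + 'k::finite) \<Rightarrow> real^('l::finite + 'k::finite)^('l + 'k)" where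
  "frame_completion u = (SOME g. orthogonal_matrix g \<and> g ** vblock 0 (mat 1) = u)"

definition funk ::
  "(real^'m^'l) measure \<Rightarrow> (real^'m^('l::finite + 'k::finite) \<Rightarrow> complex) \<Rightarrow> real^'k^('l::finite + 'k::finite) \<Rightarrow> complex" where
  "funk \<nu> f u = (\<integral>\<omega>. f (frame_completion u ** vblock \<omega> 0) \<partial>\<nu>)"

text \<open>
  Elements of \<open>L\<^sup>1(\<mu>)\<close> are represented by \<open>\<mu>\<close>-integrable functions, and equality in the target is
  equality \<open>\<sigma>\<close>-almost everywhere.  For \<open>\<mu>\<close>-integrable \<open>f\<close> the integral defining \<open>funk \<nu> f u\<close>
  converges for \<open>\<sigma>\<close>-almost every \<open>u\<close>, so the value 0 that the Bochner integral assigns to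
  non-integrable functions is taken only on a null set.
\<close>

definition funk_kernel ::
  "(real^'m^('l::finite + 'k::finite)) measure \<Rightarrow> (real^'k^('l::finite + 'k::finite)) measure \<Rightarrow> (real^'m^'l) measure
     \<Rightarrow> (real^'m^('l::finite + 'k::finite) \<Rightarrow> complex) set" where
  "funk_kernel \<mu> \<sigma> \<nu> = {f. integrable \<mu> f \<and> (AE u in \<sigma>. funk \<nu> f u = 0)}"

end

theory Submission
  imports Defs
begin

text \<open>
  One inclusion is soft.  The invariant measure on each fibre \<open>{v. transpose u ** v = 0}\<close> does not
  change under \<open>v \<mapsto> v ** \<gamma>\<close>, so the transform of \<open>f\<close> equals the transform of the average of \<open>f\<close>
  over the right action of \<open>O(m)\<close>, and averaging over \<open>u\<close> gives back \<open>\<mu>\<close>; hence an average that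
  vanishes almost everywhere is killed on almost every fibre
  (\<open>right_average_zero_imp_funk_zero\<close>).

  For the other inclusion let \<open>f\<close> be in the kernel.  Pairing the transform with a function of \<open>u\<close>
  and writing both integrals as averages over a Haar random rotation \<open>g\<close> shows that \<open>f (g ** v0)\<close>
  is orthogonal to every continuous function of \<open>g ** y\<close>, for every \<open>n \<times> k\<close> matrix \<open>y\<close> whose
  columns are orthogonal to those of \<open>v0\<close>: if \<open>u0\<close> is an orthonormal \<open>k\<close>-frame orthogonal to \<open>v0\<close>,
  such a \<open>y\<close> is a rotation fixing \<open>v0\<close> applied to \<open>u0 ** r\<close> for some \<open>k \<times> k\<close> matrix \<open>r\<close>
  (\<open>funk_zero_orthogonal_pairing\<close>).  Now let \<open>y\<close> be the projection, orthogonally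
  to \<open>v0\<close>, of a matrix \<open>Y\<close> that is uniform in the unit ball of all \<open>n \<times> k\<close> matrices, and take the
  function \<open>(x \<bullet> b) ^ (2 * d)\<close>.  The law of \<open>Y\<close> is invariant under all rotations of the matrix space,
  so the integral over \<open>Y\<close> is a positive multiple of
  \<open>norm (b - v ** (transpose v ** b)) ^ (2 * d)\<close> at \<open>v = g ** v0\<close>.  Therefore \<open>f\<close> is orthogonal to
  these functions of \<open>v\<close> for all \<open>b\<close> and \<open>d\<close> (\<open>funk_zero_moments\<close>).

  Since \<open>m \<le> k\<close>, the matrix \<open>b\<close> may consist of an orthonormal \<open>m\<close>-frame \<open>c\<close> padded by zero columns,
  and Weierstrass approximation replaces the even powers by an arbitrary continuous function of the
  distance between the column spaces of \<open>v\<close> and \<open>c\<close> (\<open>funk_zero_deviation_kernel\<close>).  Among these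
  functions are bumps supported where the two column spaces nearly coincide.  They form an
  approximate identity for functions of the column space, so \<open>f\<close> is orthogonal to every continuous
  function that is invariant under the right action of \<open>O(m)\<close>
  (\<open>funk_zero_right_invariant_test\<close>).  Consequently the right average of \<open>f\<close> is orthogonal to every
  continuous function, and it vanishes almost everywhere (\<open>funk_zero_imp_right_average_zero\<close>).

  The argument uses Haar measure on \<open>O(n)\<close>, obtained by orthonormalizing the columns of a random
  matrix (\<open>right_haar_exists\<close>), and the uniqueness of invariant measures on Stiefel manifolds, in
  the form that a Haar random rotation moves any fixed frame to a random frame with the given
  invariant law (\<open>right_haar_orbit\<close>).
\<close>

section \<open>Matrices and the orthogonal group\<close>

lemma inner_matrix_mult_left:
  fixes P :: "real^'a^'b"
  shows "(P ** A) \<bullet> B = A \<bullet> (transpose P ** B)"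
proof -
  have "(P ** A) \<bullet> B = (\<Sum>i\<in>UNIV. \<Sum>j\<in>UNIV. \<Sum>k\<in>UNIV. P $ i $ k * A $ k $ j * B $ i $ j)"
    by (simp add: inner_vec_def matrix_matrix_mult_def sum_distrib_right)
  also have "\<dots> = (\<Sum>k\<in>UNIV. \<Sum>j\<in>UNIV. \<Sum>i\<in>UNIV. P $ i $ k * A $ k $ j * B $ i $ j)"
    by (subst sum.swap, subst (2) sum.swap, subst sum.swap, rule refl)
  also have "\<dots> = A \<bullet> (transpose P ** B)"
    by (simp add: inner_vec_def matrix_matrix_mult_def transpose_def sum_distrib_left mult_ac)
  finally show ?thesis .
qed

lemma inner_transpose: "transpose A \<bullet> transpose B = A \<bullet> (B::real^'a^'b)"
  unfolding inner_vec_def transpose_def vec_lambda_beta by (rule sum.swap)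

lemma inner_matrix_mult_right:
  fixes P :: "real^'a^'b"
  shows "(A ** P) \<bullet> B = A \<bullet> (B ** transpose P)"
proof -
  have "(A ** P) \<bullet> B = (transpose P ** transpose A) \<bullet> transpose B"
    by (simp only: inner_transpose flip: matrix_transpose_mul)
  also have "\<dots> = transpose A \<bullet> transpose (B ** transpose P)"
    by (simp only: inner_matrix_mult_left matrix_transpose_mul)
  finally show ?thesis
    by (simp only: inner_transpose)
qed

lemma orthogonal_matrixD:
  fixes g :: "real^'n^'n"
  assumes "orthogonal_matrix g"
  shows "transpose g ** g = mat 1" "g ** transpose g = mat 1"
    "transpose g ** (g ** x) = x" "g ** (transpose g ** x) = x"
  using assms by (simp_all add: orthogonal_matrix_def matrix_mul_assoc)

lemma stiefel_orthogonal: "stiefel = {g::real^'n^'n. orthogonal_matrix g}"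
  by (auto simp: stiefel_def orthogonal_matrix)

lemma gram_orthogonal_mult:
  fixes g :: "real^'n^'n"
  assumes "orthogonal_matrix g"
  shows "transpose (g ** x) ** (g ** y) = transpose x ** y"
  by (simp add: matrix_transpose_mul orthogonal_matrixD(3)[OF assms] flip: matrix_mul_assoc)

lemma stiefel_mult_left: "orthogonal_matrix g \<Longrightarrow> v \<in> stiefel \<Longrightarrow> g ** v \<in> stiefel"
  by (simp add: stiefel_def gram_orthogonal_mult)

lemma stiefel_mult: "v \<in> stiefel \<Longrightarrow> w \<in> stiefel \<Longrightarrow> v ** w \<in> stiefel"
  by (simp add: stiefel_def matrix_transpose_mul) (metis matrix_mul_assoc matrix_mul_lid)

lemma norm_stiefel_mult:
  assumes "v \<in> stiefel"
  shows "norm (v ** x) = norm x"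
  using assms unfolding stiefel_def
  by (simp add: norm_eq_sqrt_inner inner_matrix_mult_left matrix_mul_assoc)

lemma norm_orthogonal_mult: "orthogonal_matrix g \<Longrightarrow> norm (g ** x) = norm (x::real^'m^'n)"
  using norm_stiefel_mult[of g x] by (simp add: stiefel_orthogonal)

lemma continuous_on_matrix_mult [continuous_intros]:
  fixes f :: "'x::topological_space \<Rightarrow> real^'b^'a" and g :: "'x \<Rightarrow> real^'c^'b"
  assumes "continuous_on S f" "continuous_on S g"
  shows "continuous_on S (\<lambda>x. f x ** g x)"
  unfolding matrix_matrix_mult_def
  by (intro continuous_on_vec_lambda continuous_intros continuous_on_component assms)

lemma continuous_on_transpose [continuous_intros]:
  fixes f :: "'x::topological_space \<Rightarrow> real^'b^'a"
  assumes "continuous_on S f"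
  shows "continuous_on S (\<lambda>x. transpose (f x))"
  unfolding transpose_def
  by (intro continuous_on_vec_lambda continuous_intros continuous_on_component assms)

lemma borel_measurable_matrix_mult [measurable (raw)]:
  fixes f :: "'x \<Rightarrow> real^'b^'a" and g :: "'x \<Rightarrow> real^'c^'b"
  assumes "f \<in> borel_measurable M" "g \<in> borel_measurable M"
  shows "(\<lambda>x. f x ** g x) \<in> borel_measurable M"
  using assms by (rule borel_measurable_continuous_Pair) (intro continuous_intros)

lemma borel_measurable_transpose [measurable (raw)]:
  fixes f :: "'x \<Rightarrow> real^'b^'a"
  assumes "f \<in> borel_measurable M"
  shows "(\<lambda>x. transpose (f x)) \<in> borel_measurable M"
  by (rule measurable_compose[OF assms borel_measurable_continuous_onI]) (intro continuous_intros)

lemma compact_stiefel: "compact (stiefel :: (real^'m^'n) set)"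
proof -
  have "closed (stiefel :: (real^'m^'n) set)"
    unfolding stiefel_def by (intro closed_Collect_eq continuous_intros)
  moreover have "norm v \<le> norm (mat 1 :: real^'m^'m)" if "v \<in> stiefel" for v :: "real^'m^'n"
    using norm_stiefel_mult[OF that, of "mat 1"] by simp
  then have "bounded (stiefel :: (real^'m^'n) set)"
    unfolding bounded_iff by blast
  ultimately show ?thesis
    by (simp add: compact_eq_bounded_closed)
qed

definition reflect :: "'a::real_inner \<Rightarrow> 'a \<Rightarrow> 'a" where
  "reflect w x = x - (2 * (w \<bullet> x) / (w \<bullet> w)) *\<^sub>R w"

lemma inner_reflect: "reflect w x \<bullet> reflect w y = x \<bullet> y"
proof (cases "w = 0")
  case False
  then have "w \<bullet> w \<noteq> 0"
    by simp
  then show ?thesis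
    by (simp add: reflect_def inner_diff_left inner_diff_right inner_commute[of x w] field_simps)
qed (simp add: reflect_def)

lemma orthogonal_transformation_reflect: "orthogonal_transformation (reflect w)"
proof -
  have "linear (reflect w)"
    by (rule linearI)
      (simp_all add: reflect_def inner_right_distrib add_divide_distrib algebra_simps)
  then show ?thesis
    by (simp add: orthogonal_transformation_def inner_reflect)
qed

lemma reflect_swap:
  assumes "norm x = norm z"
  shows "reflect (x - z) x = z"
proof (cases "x = z")
  case False
  have "2 * ((x - z) \<bullet> x) = (x - z) \<bullet> (x - z)"
    using assms by (simp add: inner_diff_left inner_diff_right inner_commute norm_eq)
  then show ?thesis
    using False by (simp add: reflect_def)
qed (simp add: reflect_def)

lemma reflect_fix: "w \<bullet> x = 0 \<Longrightarrow> reflect w x = x"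
  by (simp add: reflect_def)

definition householder :: "real^'n \<Rightarrow> real^'n^'n" where
  "householder w = mat 1 - (\<chi> i j. 2 / (w \<bullet> w) * w $ i * w $ j)"

lemma householder_vector: "householder w *v x = reflect w x"
proof -
  have "(\<chi> i j. 2 / (w \<bullet> w) * w $ i * w $ j) *v x = (2 * (w \<bullet> x) / (w \<bullet> w)) *\<^sub>R w"
    by (simp add: vec_eq_iff matrix_vector_mult_def inner_vec_def[of w x] sum_distrib_left
        sum_distrib_right sum_divide_distrib mult_ac)
  then show ?thesis
    by (simp add: householder_def reflect_def matrix_vector_mult_diff_rdistrib)
qed

lemma orthogonal_matrix_iff_inner:
  fixes M :: "real^'n^'n"
  shows "orthogonal_matrix M \<longleftrightarrow> (\<forall>x y. (M *v x) \<bullet> (M *v y) = x \<bullet> y)"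
proof -
  have "orthogonal_transformation ((*v) M) \<longleftrightarrow> orthogonal_matrix M"
    by (simp add: orthogonal_transformation_matrix)
  then show ?thesis
    by (simp add: orthogonal_transformation_def)
qed

lemma orthogonal_matrix_householder: "orthogonal_matrix (householder w)"
  by (simp add: orthogonal_matrix_iff_inner householder_vector inner_reflect)

text \<open>
  For matrices \<open>a\<close> and \<open>b\<close> with the same Gram matrix this corrects one column after the other.
  The reflection that moves the image of the next column to its target fixes all columns that are
  already in place, because both vectors have the same inner products with them.  The explicit
  recursion, in place of a mere existence statement, makes the rotation depend measurably on \<open>b\<close>.
\<close>

primrec align_columns :: "real^'p^'n \<Rightarrow> real^'p^'n \<Rightarrow> 'p list \<Rightarrow> real^'n^'n" where
  "align_columns a b [] = mat 1"
| "align_columns a b (j # js) =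
     (let g = align_columns a b js in householder (g *v column j a - column j b) ** g)"

lemma orthogonal_matrix_align_columns: "orthogonal_matrix (align_columns a b js)"
  by (induction js)
    (auto simp: Let_def orthogonal_matrix_id orthogonal_matrix_householder intro: orthogonal_matrix_mul)

lemma align_columns_column:
  assumes gram: "transpose a ** a = transpose b ** b" and "i \<in> set js"
  shows "align_columns a b js *v column i a = column i b"
  using assms(2)
proof (induction js)
  case (Cons j js)
  let ?g = "align_columns a b js"
  have inner: "column i a \<bullet> column j a = column i b \<bullet> column j b" for i j
    using gram by (simp add: matrix_mult_transpose_dot_column vec_eq_iff)
  have g: "(?g *v x) \<bullet> (?g *v y) = x \<bullet> y" for x y
    using orthogonal_matrix_align_columns orthogonal_matrix_iff_inner by blast
  show ?case
  proof (cases "i \<in> set js")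
    case True
    then have i: "?g *v column i a = column i b"
      using Cons.IH by blast
    have "(?g *v column j a - column j b) \<bullet> column i b = 0"
      using inner g[of "column j a" "column i a"] by (simp add: inner_diff_left i)
    then show ?thesis
      by (simp add: Let_def i householder_vector reflect_fix flip: matrix_vector_mul_assoc)
  next
    case False
    with Cons.prems have "i = j"
      by simp
    moreover have "norm (?g *v column j a) = norm (column j b)"
      by (simp add: norm_eq_sqrt_inner g inner)
    ultimately show ?thesis
      by (simp add: Let_def householder_vector reflect_swap flip: matrix_vector_mul_assoc)
  qed
qed simp

lemma column_matrix_mult: "column j (A ** B) = A *v column j B"
  by (simp add: vec_eq_iff column_def matrix_matrix_mult_def matrix_vector_mult_def)

definition align :: "real^'p^'n \<Rightarrow> real^'p^'n \<Rightarrow> real^'n^'n" where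
  "align a b = align_columns a b (SOME js. set js = UNIV)"

lemma orthogonal_matrix_align: "orthogonal_matrix (align a b)"
  by (simp add: align_def orthogonal_matrix_align_columns)

lemma align_mult:
  fixes a b :: "real^'p^'n"
  assumes "transpose a ** a = transpose b ** b"
  shows "align a b ** a = b"
proof -
  have "set (SOME js. set js = (UNIV::'p set)) = UNIV"
    by (rule someI_ex[OF finite_list]) simp
  then have "column j (align a b ** a) = column j b" for j
    by (simp add: column_matrix_mult align_def align_columns_column[OF assms])
  then show ?thesis
    by (simp add: vec_eq_iff column_def)
qed

definition hcat :: "real^'a^'n \<Rightarrow> real^'b^'n \<Rightarrow> real^('a::finite + 'b::finite)^'n" where
  "hcat v y = (\<chi> i j. case j of Inl a \<Rightarrow> v $ i $ a | Inr b \<Rightarrow> y $ i $ b)"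

text \<open>
  The situation of \<open>align_mult\<close> for two blocks of columns at once: transitivity of the orthogonal
  group on pairs of matrices with given Gram data.
\<close>

lemma align_pair:
  fixes v w :: "real^'a::finite^'n" and y z :: "real^'b::finite^'n"
  assumes "transpose v ** v = transpose w ** w" "transpose v ** y = transpose w ** z"
    "transpose y ** y = transpose z ** z"
  obtains g where "orthogonal_matrix g" "g ** v = w" "g ** y = z"
proof
  let ?g = "align (hcat v y) (hcat w z)"
  have "transpose y ** v = transpose z ** w"
    using arg_cong[OF assms(2), of transpose] by (simp add: matrix_transpose_mul)
  then have "(transpose (hcat v y) ** hcat v y) $ i $ j = (transpose (hcat w z) ** hcat w z) $ i $ j" for i j
    using assms by (cases i; cases j) (simp_all add: vec_eq_iff matrix_matrix_mult_def transpose_def hcat_def)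
  then have "transpose (hcat v y) ** hcat v y = transpose (hcat w z) ** hcat w z"
    by (simp add: vec_eq_iff)
  then have eq: "?g ** hcat v y = hcat w z"
    by (rule align_mult)
  show "orthogonal_matrix ?g"
    by (rule orthogonal_matrix_align)
  have "(?g ** v) $ i $ a = w $ i $ a" for i a
    using arg_cong[OF eq, of "\<lambda>x. x $ i $ Inl a"] by (simp add: hcat_def matrix_matrix_mult_def)
  then show "?g ** v = w"
    by (simp add: vec_eq_iff)
  have "(?g ** y) $ i $ b = z $ i $ b" for i b
    using arg_cong[OF eq, of "\<lambda>x. x $ i $ Inr b"] by (simp add: hcat_def matrix_matrix_mult_def)
  then show "?g ** y = z"
    by (simp add: vec_eq_iff)
qed

lemma borel_measurable_matrix_vector [measurable (raw)]:
  fixes f :: "'x \<Rightarrow> real^'b^'a" and g :: "'x \<Rightarrow> real^'b"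
  assumes "f \<in> borel_measurable M" "g \<in> borel_measurable M"
  shows "(\<lambda>x. f x *v g x) \<in> borel_measurable M"
  using assms unfolding matrix_vector_mult_def
  by (rule borel_measurable_continuous_Pair)
    (intro continuous_on_vec_lambda continuous_intros continuous_on_component)

lemma borel_measurable_vec_lambda:
  fixes f :: "'x \<Rightarrow> 'i::finite \<Rightarrow> 'b::euclidean_space"
  assumes "\<And>i. (\<lambda>x. f x i) \<in> borel_measurable M"
  shows "(\<lambda>x. \<chi> i. f x i) \<in> borel_measurable M"
proof (subst borel_measurable_euclidean_space, intro ballI)
  fix b :: "'b^'i" assume "b \<in> Basis"
  show "(\<lambda>x. (\<chi> i. f x i) \<bullet> b) \<in> borel_measurable M"
    unfolding inner_vec_def vec_lambda_beta
    by (intro borel_measurable_sum borel_measurable_inner borel_measurable_const assms)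
qed

lemma borel_measurable_vec_nth [measurable (raw)]:
  fixes f :: "'x \<Rightarrow> ('b::euclidean_space)^'i"
  assumes "f \<in> borel_measurable M"
  shows "(\<lambda>x. f x $ i) \<in> borel_measurable M"
  by (rule measurable_compose[OF assms borel_measurable_continuous_onI])
    (intro continuous_on_component continuous_on_id)

lemma borel_measurable_column [measurable (raw)]:
  fixes f :: "'x \<Rightarrow> real^'b^'a"
  assumes "f \<in> borel_measurable M"
  shows "(\<lambda>x. column j (f x)) \<in> borel_measurable M"
  unfolding column_def using assms by (intro borel_measurable_vec_lambda) measurable

lemma borel_measurable_align: "align a \<in> borel_measurable borel"
proof -
  have hh[measurable]: "householder \<in> borel_measurable borel"
    unfolding householder_def
    by (intro borel_measurable_diff borel_measurable_const borel_measurable_vec_lambda) measurable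
  have cols: "(\<lambda>b. align_columns a b js) \<in> borel_measurable borel" for js
  proof (induction js)
    case (Cons j js)
    note Cons[measurable]
    show ?case
      unfolding align_columns.simps Let_def by measurable
  qed simp
  have "align a = (\<lambda>b. align_columns a b (SOME js. set js = UNIV))"
    by (rule ext) (simp add: align_def)
  then show ?thesis
    by (simp only: cols)
qed

section \<open>Lebesgue measure under linear isometries\<close>

lemma emeasure_lborel_open_nonzero:
  fixes S :: "'a::euclidean_space set"
  assumes "open S" "S \<noteq> {}"
  shows "emeasure lborel S \<noteq> 0"
proof
  assume "emeasure lborel S = 0"
  then have "negligible S"
    using assms(1) by (simp add: negligible_iff_null_sets null_sets_completionI null_setsI)
  then show False
    using open_not_negligible[OF assms] by simp
qed

lemma nn_integral_lborel_translate:
  fixes a :: "'a::euclidean_space"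
  assumes "f \<in> borel_measurable borel"
  shows "(\<integral>\<^sup>+x. f (x + a) \<partial>lborel) = (\<integral>\<^sup>+x. f x \<partial>lborel)"
proof -
  have "(\<integral>\<^sup>+x. f x \<partial>lborel) = (\<integral>\<^sup>+x. f x \<partial>distr lborel borel ((+) a))"
    by (simp add: lborel_distr_plus)
  also have "\<dots> = (\<integral>\<^sup>+x. f (x + a) \<partial>lborel)"
    by (subst nn_integral_distr) (use assms in \<open>auto simp: add.commute\<close>)
  finally show ?thesis ..
qed

text \<open>
  The image of Lebesgue measure under an isometry is again translation invariant.  Integrating
  \<open>indicator A (T x) * indicator B (y - T x)\<close> over \<open>x\<close> and \<open>y\<close> in both orders, with translations in
  between, gives the equation \<open>|T\<inverse> A| |B| = |A| |T\<inverse> B|\<close> up to a reflection of \<open>B\<close>.  The unit ball \<open>B\<close>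
  is symmetric and satisfies \<open>|T\<inverse> B| = |B|\<close> with a finite positive value, which can be cancelled.
\<close>

lemma lborel_distr_orthogonal_transformation:
  fixes T :: "'a::euclidean_space \<Rightarrow> 'a"
  assumes T: "orthogonal_transformation T"
  shows "distr lborel borel T = lborel"
proof (rule measure_eqI)
  fix A :: "'a set" assume "A \<in> sets (distr lborel borel T)"
  then have A[measurable]: "A \<in> sets borel"
    by simp
  have [measurable]: "T \<in> borel_measurable borel"
    using T by (intro borel_measurable_continuous_onI linear_continuous_on)
      (simp add: linear_linear orthogonal_transformation_linear)
  have linear: "linear T"
    using T by (rule orthogonal_transformation_linear)
  define B where "B = ball (0::'a) 1"
  have B[measurable]: "B \<in> sets borel"
    by (simp add: B_def)
  define LB where "LB = emeasure lborel B"
  have "emeasure (distr lborel borel T) A * LB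
      = (\<integral>\<^sup>+x. indicator A (T x) * (\<integral>\<^sup>+y. indicator B y \<partial>lborel) \<partial>lborel)"
  proof -
    have "emeasure (distr lborel borel T) A = (\<integral>\<^sup>+x. indicator A x \<partial>distr lborel borel T)"
      by simp
    also have "\<dots> = (\<integral>\<^sup>+x. indicator A (T x) \<partial>lborel)"
      by (rule nn_integral_distr) measurable
    finally show ?thesis
      unfolding LB_def by (simp add: nn_integral_multc)
  qed
  also have "\<dots> = (\<integral>\<^sup>+x. \<integral>\<^sup>+y. indicator A (T x) * indicator B (y - T x) \<partial>lborel \<partial>lborel)"
  proof (rule nn_integral_cong)
    fix x
    have "indicator A (T x) * (\<integral>\<^sup>+y. indicator B y \<partial>lborel) = (\<integral>\<^sup>+y. indicator A (T x) * indicator B y \<partial>lborel)"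
      by (rule nn_integral_cmult[symmetric]) measurable
    also have "\<dots> = (\<integral>\<^sup>+y. indicator A (T x) * indicator B (y + - T x) \<partial>lborel)"
      by (rule nn_integral_lborel_translate[symmetric]) measurable
    finally show "indicator A (T x) * (\<integral>\<^sup>+y. indicator B y \<partial>lborel)
      = (\<integral>\<^sup>+y. indicator A (T x) * indicator B (y - T x) \<partial>lborel)"
      by simp
  qed
  also have "\<dots> = (\<integral>\<^sup>+y. \<integral>\<^sup>+x. indicator A (T x) * indicator B (y - T x) \<partial>lborel \<partial>lborel)"
    by (rule lborel_pair.Fubini'[symmetric]) measurable
  also have "\<dots> = (\<integral>\<^sup>+y. \<integral>\<^sup>+x. indicator A (T x + y) * indicator B (T x) \<partial>lborel \<partial>lborel)"
  proof (rule nn_integral_cong)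
    fix y
    obtain a where a: "T a = y"
      using orthogonal_transformation_surj[OF T] by (metis surjD)
    have "(\<integral>\<^sup>+x. indicator A (T x) * indicator B (y - T x) \<partial>lborel)
      = (\<integral>\<^sup>+x. indicator A (T (x + a)) * indicator B (y - T (x + a)) \<partial>lborel)"
      by (rule nn_integral_lborel_translate[symmetric]) measurable
    then show "(\<integral>\<^sup>+x. indicator A (T x) * indicator B (y - T x) \<partial>lborel)
      = (\<integral>\<^sup>+x. indicator A (T x + y) * indicator B (T x) \<partial>lborel)"
      by (simp add: linear_add[OF linear] a indicator_def B_def)
  qed
  also have "\<dots> = (\<integral>\<^sup>+x. \<integral>\<^sup>+y. indicator A (T x + y) * indicator B (T x) \<partial>lborel \<partial>lborel)"
    by (rule lborel_pair.Fubini') measurable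
  also have "\<dots> = (\<integral>\<^sup>+x. emeasure lborel A * indicator B x \<partial>lborel)"
  proof (rule nn_integral_cong)
    fix x
    have "(\<integral>\<^sup>+y. indicator A (T x + y) * indicator B (T x) \<partial>lborel)
      = (\<integral>\<^sup>+y. indicator A (y + T x) \<partial>lborel) * indicator B (T x)"
      by (simp add: nn_integral_multc add.commute)
    also have "(\<integral>\<^sup>+y. indicator A (y + T x) \<partial>lborel) = emeasure lborel A"
      using nn_integral_lborel_translate[of "indicator A" "T x"] by simp
    finally show "(\<integral>\<^sup>+y. indicator A (T x + y) * indicator B (T x) \<partial>lborel) = emeasure lborel A * indicator B x"
      by (simp add: indicator_def B_def orthogonal_transformation_norm[OF T])
  qed
  also have "\<dots> = emeasure lborel A * LB"
    by (simp add: nn_integral_cmult LB_def)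
  finally have *: "emeasure (distr lborel borel T) A * LB = emeasure lborel A * LB" .
  have "LB \<noteq> 0"
    by (simp add: LB_def B_def emeasure_lborel_open_nonzero)
  moreover have "LB \<noteq> \<infinity>"
    using emeasure_lborel_ball_finite[of "0::'a" 1] by (simp add: LB_def B_def)
  ultimately show "emeasure (distr lborel borel T) A = emeasure lborel A"
    using * by (metis mult_divide_eq_ennreal infinity_ennreal_def)
qed simp

lemma orthogonal_transformation_matrix_mult:
  fixes g :: "real^'n^'n"
  assumes "orthogonal_matrix g"
  shows "orthogonal_transformation (\<lambda>x::real^'m^'n. g ** x)"
proof -
  have "linear (\<lambda>x::real^'m^'n. g ** x)"
    by (rule linearI) (simp_all add: matrix_add_ldistrib matrix_scalar_ac scalar_matrix_assoc)
  then show ?thesis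
    by (simp add: orthogonal_transformation norm_orthogonal_mult[OF assms])
qed

section \<open>Haar measure on the orthogonal group\<close>

fun gram_schmidt :: "(nat \<Rightarrow> 'a::euclidean_space) \<Rightarrow> nat \<Rightarrow> 'a" where
  "gram_schmidt x j =
     (let y = x j - (\<Sum>i<j. (x j \<bullet> gram_schmidt x i) *\<^sub>R gram_schmidt x i) in y /\<^sub>R norm y)"

declare gram_schmidt.simps [simp del]

text \<open>
  Orthonormalization uses inner products and linear combinations only, so it commutes with
  isometries.  This is what makes its output on a random matrix rotation invariant.
\<close>

lemma gram_schmidt_isometry:
  assumes T: "orthogonal_transformation T"
  shows "gram_schmidt (\<lambda>n. T (x n)) j = T (gram_schmidt x j)"
proof (induction j rule: less_induct)
  case (less j)
  let ?y = "x j - (\<Sum>i<j. (x j \<bullet> gram_schmidt x i) *\<^sub>R gram_schmidt x i)"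
  have linear: "linear T"
    using T by (rule orthogonal_transformation_linear)
  have "T (x j) - (\<Sum>i<j. (T (x j) \<bullet> gram_schmidt (\<lambda>n. T (x n)) i) *\<^sub>R gram_schmidt (\<lambda>n. T (x n)) i) = T ?y"
    using T less by (simp add: linear_diff[OF linear] linear_sum[OF linear] linear_scale[OF linear]
        orthogonal_transformation_def)
  then show ?case
    by (subst (1 2) gram_schmidt.simps)
      (simp add: Let_def orthogonal_transformation_norm[OF T] linear_scale[OF linear])
qed

lemma gram_schmidt_orthonormal:
  assumes indep: "\<And>j. j < N \<Longrightarrow> x j \<notin> span (x ` {..<j})"
  shows "j < N \<Longrightarrow> norm (gram_schmidt x j) = 1 \<and> gram_schmidt x j \<in> span (x ` {..j})
    \<and> (\<forall>i<j. gram_schmidt x j \<bullet> gram_schmidt x i = 0)"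
proof (induction j rule: less_induct)
  case (less j)
  let ?e = "gram_schmidt x"
  let ?s = "\<Sum>i<j. (x j \<bullet> ?e i) *\<^sub>R ?e i"
  have e: "?e j = (x j - ?s) /\<^sub>R norm (x j - ?s)"
    by (subst gram_schmidt.simps) (simp add: Let_def)
  have IH: "norm (?e i) = 1" "?e i \<in> span (x ` {..<j})" "k < i \<Longrightarrow> ?e i \<bullet> ?e k = 0" if "i < j" for i k
  proof -
    have i: "norm (?e i) = 1 \<and> ?e i \<in> span (x ` {..i}) \<and> (\<forall>k<i. ?e i \<bullet> ?e k = 0)"
      using less.IH[OF that] less.prems that by simp
    have "span (x ` {..i}) \<subseteq> span (x ` {..<j})"
      using that by (intro span_mono) auto
    then show "norm (?e i) = 1" "?e i \<in> span (x ` {..<j})" "k < i \<Longrightarrow> ?e i \<bullet> ?e k = 0"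
      using i by auto
  qed
  have s: "?s \<in> span (x ` {..<j})"
    using IH by (intro span_sum span_scale) auto
  then have ne: "x j - ?s \<noteq> 0"
    using indep[OF less.prems] by auto
  have "x ` {..<j} \<subseteq> x ` {..j}"
    by auto
  then have "?s \<in> span (x ` {..j})"
    using s span_mono by blast
  then have "?e j \<in> span (x ` {..j})"
    unfolding e by (intro span_scale span_diff) (auto intro: span_base)
  moreover have "?e j \<bullet> ?e i = 0" if "i < j" for i
  proof -
    have *: "?e k \<bullet> ?e i = (if k = i then 1 else 0)" if "k < j" for k
      using IH(1)[of i] IH(3)[of i k] IH(3)[of k i] that \<open>i < j\<close>
      by (cases k i rule: linorder_cases) (auto simp: inner_commute[of "?e k"] norm_eq_1)
    have "?s \<bullet> ?e i = (\<Sum>k<j. (x j \<bullet> ?e k) * (if k = i then 1 else 0))"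
      by (simp add: inner_sum_left *)
    also have "\<dots> = x j \<bullet> ?e i"
      using that by (simp add: if_distrib cong: if_cong)
    finally show ?thesis
      by (simp add: e inner_diff_left)
  qed
  ultimately show ?case
    using ne by (simp add: e)
qed

lemma borel_measurable_gram_schmidt:
  assumes "\<And>n. (\<lambda>w. x w n) \<in> borel_measurable M"
  shows "(\<lambda>w. gram_schmidt (x w) j) \<in> borel_measurable M"
proof (induction j rule: less_induct)
  case (less j)
  note assms[measurable]
  have [measurable]: "(\<lambda>w. x w j - (\<Sum>i<j. (x w j \<bullet> gram_schmidt (x w) i) *\<^sub>R gram_schmidt (x w) i)) \<in> borel_measurable M"
    using less by (intro borel_measurable_diff borel_measurable_sum borel_measurable_scaleR
        borel_measurable_inner assms) auto
  show ?case
    by (subst gram_schmidt.simps) (simp only: Let_def, measurable)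
qed

lemma det_nonzero_columns_independent:
  fixes X :: "real^'n^'n" and c :: "nat \<Rightarrow> 'n"
  assumes "det X \<noteq> 0" "inj_on c {..<N}" "j < N"
  shows "column (c j) X \<notin> span ((\<lambda>i. column (c i) X) ` {..<j})"
proof
  assume *: "column (c j) X \<in> span ((\<lambda>i. column (c i) X) ` {..<j})"
  have "column (c i) X \<noteq> column (c j) X" if "i < j" for i
  proof -
    have "c i \<noteq> c j"
      using inj_onD[OF assms(2), of i j] assms(3) that by auto
    then show ?thesis
      using det_identical_columns[of "c i" "c j" X] assms(1) by auto
  qed
  then have "(\<lambda>i. column (c i) X) ` {..<j} \<subseteq> columns X - {column (c j) X}"
    by (auto simp: columns_def)
  then have "column (c j) X \<in> span (columns X - {column (c j) X})"
    using * span_mono by blast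
  then have "dependent (columns X)"
    unfolding dependent_def by (auto simp: columns_def)
  then show False
    using assms(1) det_dependent_columns dependent_vec_eq by blast
qed

lemma continuous_on_det [continuous_intros]:
  fixes f :: "'x::topological_space \<Rightarrow> real^'n^'n"
  assumes "continuous_on S f"
  shows "continuous_on S (\<lambda>x. det (f x))"
  unfolding det_def by (intro continuous_intros continuous_on_component assms)

text \<open>
  On singular matrices the value \<open>mat 1\<close> serves as a default that keeps \<open>Q\<close> inside the orthogonal
  group; equivariance is lost there.
\<close>

lemma equivariant_orthogonalization_exists:
  obtains Q :: "real^'n^'n \<Rightarrow> real^'n^'n" where
    "Q \<in> borel_measurable borel"
    "\<And>X. orthogonal_matrix (Q X)"
    "\<And>g X. orthogonal_matrix g \<Longrightarrow> det X \<noteq> 0 \<Longrightarrow> Q (g ** X) = g ** Q X"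
proof -
  obtain c :: "nat \<Rightarrow> 'n" where c: "bij_betw c {0..<CARD('n)} UNIV"
    using ex_bij_betw_nat_finite[of "UNIV :: 'n set"] by auto
  define num where "num = the_inv_into {0..<CARD('n)} c"
  have num: "num j < CARD('n)" "c (num j) = j" for j
    using c f_the_inv_into_f_bij_betw[OF c] the_inv_into_into[of c "{0..<CARD('n)}" j "{0..<CARD('n)}"]
    by (auto simp: num_def bij_betw_def)
  define P where "P X = (\<chi> i j. gram_schmidt (\<lambda>n. column (c n) X) (num j) $ i)" for X :: "real^'n^'n"
  have P_column: "column j (P X) = gram_schmidt (\<lambda>n. column (c n) X) (num j)" for X j
    by (simp add: P_def column_def)
  have P_meas[measurable]: "P \<in> borel_measurable borel"
    unfolding P_def by (intro borel_measurable_vec_lambda borel_measurable_vec_nth borel_measurable_gram_schmidt) measurable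
  have P_orth: "orthogonal_matrix (P X)" if "det X \<noteq> 0" for X
  proof -
    have "inj_on c {..<CARD('n)}"
      using c by (simp add: bij_betw_def atLeast0LessThan)
    then have indep: "column (c j) X \<notin> span ((\<lambda>i. column (c i) X) ` {..<j})" if "j < CARD('n)" for j
      using det_nonzero_columns_independent \<open>det X \<noteq> 0\<close> that by blast
    have gs: "norm (gram_schmidt (\<lambda>n. column (c n) X) (num j)) = 1"
      "i < num j \<Longrightarrow> gram_schmidt (\<lambda>n. column (c n) X) (num j) \<bullet> gram_schmidt (\<lambda>n. column (c n) X) i = 0" for i j
      using gram_schmidt_orthonormal[of "CARD('n)" "\<lambda>n. column (c n) X", OF indep num(1)] by auto
    show ?thesis
      unfolding orthogonal_matrix_orthonormal_columns P_column
    proof (intro conjI allI impI)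
      fix i j :: 'n assume "i \<noteq> j"
      then have "num i < num j \<or> num j < num i"
        using num(2) by (metis linorder_neqE_nat)
      then show "orthogonal (gram_schmidt (\<lambda>n. column (c n) X) (num i)) (gram_schmidt (\<lambda>n. column (c n) X) (num j))"
        using gs(2) by (metis orthogonal_def inner_commute)
    qed (use gs in blast)
  qed
  have P_equi: "P (g ** X) = g ** P X" if "orthogonal_matrix g" for g X
  proof -
    have "orthogonal_transformation ((*v) g)"
      using that by (simp add: orthogonal_transformation_matrix)
    then have "column j (P (g ** X)) = column j (g ** P X)" for j
      by (simp add: P_column column_matrix_mult gram_schmidt_isometry[of "(*v) g"])
    then show ?thesis
      by (simp add: vec_eq_iff column_def)
  qed
  have [measurable]: "(det :: real^'n^'n \<Rightarrow> real) \<in> borel_measurable borel"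
    by (intro borel_measurable_continuous_onI continuous_on_det continuous_on_id)
  show ?thesis
  proof
    show "(\<lambda>X. if det X \<noteq> 0 then P X else mat 1) \<in> borel_measurable borel"
      by measurable
    fix g X :: "real^'n^'n"
    show "orthogonal_matrix (if det X \<noteq> 0 then P X else mat 1)"
      by (simp add: P_orth orthogonal_matrix_id)
    assume "orthogonal_matrix g" "det X \<noteq> 0"
    then show "(if det (g ** X) \<noteq> 0 then P (g ** X) else mat 1) = g ** (if det X \<noteq> 0 then P X else mat 1)"
      using det_orthogonal_matrix[of g] by (auto simp: det_mul P_equi)
  qed
qed

text \<open>
  The right-handed version of invariance is the one that fits the left action on frames: the
  average of \<open>f (g ** v)\<close> over \<open>g\<close> is then unchanged when \<open>v\<close> is replaced by \<open>h ** v\<close>.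
\<close>

definition right_haar :: "(real^'n^'n) measure \<Rightarrow> bool" where
  "right_haar H \<longleftrightarrow>
     prob_space H \<and> sets H = sets (restrict_space borel {g. orthogonal_matrix g}) \<and>
     (\<forall>h. orthogonal_matrix h \<longrightarrow> distr H H (\<lambda>g. g ** h) = H)"

text \<open>
  Lebesgue measure on the invertible matrices of bounded norm is a finite measure, and it is
  invariant under left multiplication by rotations.  Orthonormalizing the columns carries it to a
  left invariant measure on the orthogonal group, and transposition exchanges left and right.
\<close>

lemma right_haar_exists: "\<exists>H :: (real^'n^'n) measure. right_haar H"
proof -
  obtain Q :: "real^'n^'n \<Rightarrow> real^'n^'n" where
    Q_borel[measurable]: "Q \<in> borel_measurable borel" and
    Q_orth: "\<And>X. orthogonal_matrix (Q X)" and
    Q_mult: "\<And>g X. orthogonal_matrix g \<Longrightarrow> det X \<noteq> 0 \<Longrightarrow> Q (g ** X) = g ** Q X"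
    by (rule equivariant_orthogonalization_exists) blast
  define R :: "(real^'n^'n) measure" where "R = restrict_space borel {g. orthogonal_matrix g}"
  \<comment> \<open>Any bound above \<open>norm (mat 1)\<close> keeps \<open>S\<close> nonempty.\<close>
  define S :: "(real^'n^'n) set" where "S = {X. norm X < norm (mat 1 :: real^'n^'n) + 1 \<and> det X \<noteq> 0}"
  define U where "U = uniform_measure lborel S"
  have "open S"
    unfolding S_def by (intro open_Collect_conj open_Collect_less open_Collect_neq continuous_intros)
  then have S[measurable]: "S \<in> sets borel"
    by simp
  have "mat 1 \<in> S"
    by (simp add: S_def)
  then have S0: "emeasure lborel S \<noteq> 0"
    using emeasure_lborel_open_nonzero[OF \<open>open S\<close>] by blast
  have "S \<subseteq> ball 0 (norm (mat 1 :: real^'n^'n) + 1)"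
    by (auto simp: S_def)
  then have S1: "emeasure lborel S \<noteq> \<infinity>"
    using emeasure_mono[of S _ lborel] emeasure_lborel_ball_finite by (metis infinity_ennreal_def neq_top_trans sets_lborel borel_open open_ball less_irrefl)
  interpret U: prob_space U
    unfolding U_def using S0 S1 by (rule prob_space_uniform_measure)
  have sets_U[measurable_cong]: "sets U = sets borel"
    by (simp add: U_def)
  have AE_S: "AE X in U. X \<in> S"
    unfolding U_def by (rule AE_uniform_measureI) auto
  have Q_R[measurable]: "Q \<in> U \<rightarrow>\<^sub>M R"
    unfolding R_def using Q_orth by (intro measurable_restrict_space2) auto
  have mult_R: "(\<lambda>x. g ** x) \<in> R \<rightarrow>\<^sub>M R" "(\<lambda>x. x ** g) \<in> R \<rightarrow>\<^sub>M R" if "orthogonal_matrix g" for g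
    unfolding R_def using that
    by (auto intro!: measurable_restrict_space3 orthogonal_matrix_mul)
  have transpose_R[measurable]: "transpose \<in> R \<rightarrow>\<^sub>M R"
    unfolding R_def by (auto intro!: measurable_restrict_space3)
  have U_inv: "distr U borel (\<lambda>X. g ** X) = U" if g: "orthogonal_matrix g" for g
  proof (rule measure_eqI)
    fix A assume "A \<in> sets (distr U borel (\<lambda>X. g ** X))"
    then have A[measurable]: "A \<in> sets borel"
      by simp
    have gS: "g ** X \<in> S \<longleftrightarrow> X \<in> S" for X
      using det_orthogonal_matrix[OF g] by (auto simp: S_def norm_orthogonal_mult[OF g] det_mul)
    have "emeasure lborel (S \<inter> A) = emeasure (distr lborel borel (\<lambda>X. g ** X)) (S \<inter> A)"
      by (simp add: lborel_distr_orthogonal_transformation orthogonal_transformation_matrix_mult[OF g])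
    also have "\<dots> = emeasure lborel (S \<inter> {X. g ** X \<in> A})"
      by (subst emeasure_distr) (auto simp: gS intro!: arg_cong[where f = "emeasure lborel"])
    finally show "emeasure (distr U borel (\<lambda>X. g ** X)) A = emeasure U A"
      by (subst emeasure_distr) (auto simp: U_def emeasure_uniform_measure vimage_def)
  qed (simp add: sets_U)
  define L where "L = distr U R Q"
  have L_inv: "distr L R (\<lambda>x. g ** x) = L" if g: "orthogonal_matrix g" for g
  proof -
    note mult_R[OF g, measurable]
    have "distr L R (\<lambda>x. g ** x) = distr U R (\<lambda>X. g ** Q X)"
      unfolding L_def by (subst distr_distr) (auto simp: comp_def)
    also have "\<dots> = distr U R (\<lambda>X. Q (g ** X))"
      using AE_S by (intro distr_cong_AE) (auto simp: Q_mult[OF g] S_def)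
    also have "\<dots> = distr (distr U borel (\<lambda>X. g ** X)) R Q"
      by (subst distr_distr) (auto simp: comp_def)
    finally show ?thesis
      by (simp add: U_inv[OF g] L_def)
  qed
  define H where "H = distr L R transpose"
  have [measurable_cong]: "sets L = sets R" "sets H = sets R"
    by (simp_all add: L_def H_def)
  have "distr H R (\<lambda>x. x ** h) = H" if h: "orthogonal_matrix h" for h
  proof -
    have h': "orthogonal_matrix (transpose h)"
      using h by simp
    note mult_R[OF h, measurable] mult_R[OF h', measurable]
    have "distr H R (\<lambda>x. x ** h) = distr L R (\<lambda>x. transpose (transpose h ** x))"
      unfolding H_def by (subst distr_distr) (auto simp: comp_def matrix_transpose_mul)
    also have "\<dots> = distr (distr L R (\<lambda>x. transpose h ** x)) R transpose"
      by (subst distr_distr) (auto simp: comp_def)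
    finally show ?thesis
      by (simp add: L_inv[OF h'] H_def)
  qed
  moreover have "distr H H f = distr H R f" for f
    by (rule distr_cong) (simp_all add: H_def)
  moreover have "prob_space H"
    unfolding H_def L_def
    by (intro prob_space.prob_space_distr U.prob_space_distr) (simp_all, measurable)
  ultimately have "right_haar H"
    by (simp add: right_haar_def R_def H_def)
  then show ?thesis ..
qed

section \<open>Uniqueness of invariant measures\<close>

lemma measurable_restricted_iff:
  assumes "sets M = sets (restrict_space borel S)"
  shows "f \<in> N \<rightarrow>\<^sub>M M \<longleftrightarrow> f \<in> borel_measurable N \<and> f \<in> space N \<rightarrow> S"
  using measurable_cong_sets[OF refl assms, of N] by (simp add: measurable_restrict_space2_iff)

lemma measurable_restricted_id:
  assumes "sets M = sets (restrict_space borel S)"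
  shows "(\<lambda>x. x) \<in> borel_measurable M"
  by (subst measurable_cong_sets[OF assms refl]) (simp add: measurable_restrict_space1)

lemma invariant_probD:
  assumes "invariant_prob S M"
  shows "prob_space M" "sets M = sets (restrict_space borel S)" "space M = S"
    "orthogonal_matrix g \<Longrightarrow> distr M M (\<lambda>v. g ** v) = M"
  using assms sets_eq_imp_space_eq[of M "restrict_space borel S"]
  by (auto simp: invariant_prob_def space_restrict_space)

lemma right_haarD:
  assumes "right_haar H"
  shows "prob_space H" "sets H = sets (restrict_space borel {g. orthogonal_matrix g})"
    "space H = {g. orthogonal_matrix g}"
    "orthogonal_matrix h \<Longrightarrow> distr H H (\<lambda>g. g ** h) = H"
    "orthogonal_matrix h \<Longrightarrow> (\<lambda>g. g ** h) \<in> H \<rightarrow>\<^sub>M H"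
proof -
  show *: "prob_space H" "sets H = sets (restrict_space borel {g. orthogonal_matrix g})"
    "orthogonal_matrix h \<Longrightarrow> distr H H (\<lambda>g. g ** h) = H"
    using assms by (auto simp: right_haar_def)
  show **: "space H = {g. orthogonal_matrix g}"
    using sets_eq_imp_space_eq[OF *(2)] by (simp add: space_restrict_space)
  show "(\<lambda>g. g ** h) \<in> H \<rightarrow>\<^sub>M H" if "orthogonal_matrix h"
    using measurable_restricted_id[OF *(2)] that
    by (auto simp: measurable_restricted_iff[OF *(2)] ** intro: orthogonal_matrix_mul)
qed

lemma measurable_mult_pair:
  fixes M1 :: "(real^'b^'a) measure" and M2 :: "(real^'c^'b) measure"
  assumes "sets M1 = sets (restrict_space borel S1)" "sets M2 = sets (restrict_space borel S2)"
    "sets N = sets (restrict_space borel S)" "\<And>x y. x \<in> S1 \<Longrightarrow> y \<in> S2 \<Longrightarrow> x ** y \<in> S"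
  shows "(\<lambda>(x, y). x ** y) \<in> M1 \<Otimes>\<^sub>M M2 \<rightarrow>\<^sub>M N"
proof -
  have "(\<lambda>p. fst p) \<in> borel_measurable (M1 \<Otimes>\<^sub>M M2)" "(\<lambda>p. snd p) \<in> borel_measurable (M1 \<Otimes>\<^sub>M M2)"
    by (auto intro!: measurable_compose[OF measurable_fst measurable_restricted_id[OF assms(1)]]
        measurable_compose[OF measurable_snd measurable_restricted_id[OF assms(2)]])
  moreover have "space M1 = S1" "space M2 = S2"
    using assms(1,2)[THEN sets_eq_imp_space_eq] by (simp_all add: space_restrict_space)
  ultimately show ?thesis
    using assms(4) by (auto simp: measurable_restricted_iff[OF assms(3)] space_pair_measure split_beta)
qed

lemma measurable_mult_left:
  fixes M :: "(real^'m^'n) measure"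
  assumes "sets M = sets (restrict_space borel stiefel)" "orthogonal_matrix g"
  shows "(\<lambda>v. g ** v) \<in> M \<rightarrow>\<^sub>M M"
  using measurable_restricted_id[OF assms(1)] sets_eq_imp_space_eq[OF assms(1)] assms(2)
  by (auto simp: measurable_restricted_iff[OF assms(1)] space_restrict_space stiefel_mult_left)

text \<open>
  Uniqueness of the invariant measure: \<open>M A\<close> is the average of \<open>indicator A (g ** v)\<close> over \<open>v\<close> for
  each \<open>g\<close>, hence also over \<open>v\<close> and \<open>g\<close>; but the average over \<open>g\<close> alone is the same for all \<open>v\<close>,
  because frames form a single orbit.
\<close>

lemma right_haar_orbit:
  fixes M :: "(real^'m^'n) measure" and H :: "(real^'n^'n) measure"
  assumes M: "invariant_prob stiefel M" and H: "right_haar H" and v0: "v0 \<in> stiefel"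
  shows "(\<lambda>g. g ** v0) \<in> H \<rightarrow>\<^sub>M M" "distr H M (\<lambda>g. g ** v0) = M"
proof -
  note M' = invariant_probD[OF M] and H' = right_haarD[OF H]
  interpret M: prob_space M by (rule M'(1))
  interpret H: prob_space H by (rule H'(1))
  interpret P: pair_prob_space H M ..
  have orbit[measurable]: "(\<lambda>g. g ** v) \<in> H \<rightarrow>\<^sub>M M" if "v \<in> stiefel" for v
    using measurable_restricted_id[OF H'(2)] that H'(3)
    by (auto simp: measurable_restricted_iff[OF M'(2)] stiefel_mult_left)
  show "(\<lambda>g. g ** v0) \<in> H \<rightarrow>\<^sub>M M"
    using v0 by (rule orbit)
  show "distr H M (\<lambda>g. g ** v0) = M"
  proof (rule measure_eqI)
    fix A assume "A \<in> sets (distr H M (\<lambda>g. g ** v0))"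
    then have A[measurable]: "A \<in> sets M"
      by simp
    have [measurable]: "(\<lambda>(g, v). g ** v) \<in> H \<Otimes>\<^sub>M M \<rightarrow>\<^sub>M M"
      using H'(2) M'(2) M'(2) by (rule measurable_mult_pair) (simp add: stiefel_mult_left)
    have pair: "(\<lambda>(g, v). indicator A (g ** v) :: ennreal) \<in> borel_measurable (H \<Otimes>\<^sub>M M)"
      using measurable_compose[OF \<open>(\<lambda>(g, v). g ** v) \<in> H \<Otimes>\<^sub>M M \<rightarrow>\<^sub>M M\<close>, of "indicator A"]
      by (simp add: split_beta')
    have "emeasure M A = (\<integral>\<^sup>+g. emeasure M A \<partial>H)"
      by (simp add: H.emeasure_space_1)
    also have "\<dots> = (\<integral>\<^sup>+g. \<integral>\<^sup>+v. indicator A (g ** v) \<partial>M \<partial>H)"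
    proof (rule nn_integral_cong)
      fix g assume "g \<in> space H"
      then have g: "orthogonal_matrix g"
        using H'(3) by simp
      note measurable_mult_left[OF M'(2) g, measurable]
      have "emeasure M A = (\<integral>\<^sup>+v. indicator A v \<partial>distr M M (\<lambda>v. g ** v))"
        by (simp add: M'(4)[OF g])
      also have "\<dots> = (\<integral>\<^sup>+v. indicator A (g ** v) \<partial>M)"
        by (rule nn_integral_distr) measurable
      finally show "emeasure M A = (\<integral>\<^sup>+v. indicator A (g ** v) \<partial>M)" .
    qed
    also have "\<dots> = (\<integral>\<^sup>+v. \<integral>\<^sup>+g. indicator A (g ** v) \<partial>H \<partial>M)"
      by (rule P.Fubini'[symmetric]) (rule pair)
    also have "\<dots> = (\<integral>\<^sup>+v. (\<integral>\<^sup>+g. indicator A (g ** v0) \<partial>H) \<partial>M)"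
    proof (rule nn_integral_cong)
      fix v assume "v \<in> space M"
      then have v: "v \<in> stiefel"
        using M'(3) by simp
      define h where "h = align v0 v"
      have h: "orthogonal_matrix h" "h ** v0 = v"
        using v v0 by (auto simp: h_def orthogonal_matrix_align stiefel_def intro!: align_mult)
      note H'(5)[OF h(1), measurable] orbit[OF v0, measurable]
      have "(\<integral>\<^sup>+g. indicator A (g ** v0) \<partial>H) = (\<integral>\<^sup>+g. indicator A (g ** v0) \<partial>distr H H (\<lambda>g. g ** h))"
        by (simp add: H'(4)[OF h(1)])
      also have "\<dots> = (\<integral>\<^sup>+g. indicator A (g ** v) \<partial>H)"
        by (subst nn_integral_distr) (auto simp: h(2) simp flip: matrix_mul_assoc)
      finally show "(\<integral>\<^sup>+g. indicator A (g ** v) \<partial>H) = (\<integral>\<^sup>+g. indicator A (g ** v0) \<partial>H)" ..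
    qed
    also have "\<dots> = (\<integral>\<^sup>+v. indicator A v \<partial>distr H M (\<lambda>g. g ** v0))"
      using orbit[OF v0] by (simp add: M.emeasure_space_1 nn_integral_distr del: nn_integral_indicator)
    finally show "emeasure (distr H M (\<lambda>g. g ** v0)) A = emeasure M A"
      by simp
  qed simp
qed

text \<open>
  Left and right multiplication commute, so the right translate of an orbit average is the orbit
  average over another starting frame.
\<close>

lemma invariant_prob_right:
  fixes M :: "(real^'m^'n) measure"
  assumes M: "invariant_prob stiefel M" and \<gamma>: "orthogonal_matrix \<gamma>"
  shows "(\<lambda>v. v ** \<gamma>) \<in> M \<rightarrow>\<^sub>M M" "distr M M (\<lambda>v. v ** \<gamma>) = M"
proof -
  note M' = invariant_probD[OF M]
  interpret M: prob_space M by (rule M'(1))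
  obtain v0 :: "real^'m^'n" where v0: "v0 \<in> stiefel"
    using M.not_empty M'(3) by auto
  obtain H :: "(real^'n^'n) measure" where H: "right_haar H"
    using right_haar_exists by blast
  have \<gamma>': "\<gamma> \<in> stiefel"
    using \<gamma> by (simp add: stiefel_orthogonal)
  show *: "(\<lambda>v. v ** \<gamma>) \<in> M \<rightarrow>\<^sub>M M"
    using measurable_restricted_id[OF M'(2)] M'(3) \<gamma>'
    by (auto simp: measurable_restricted_iff[OF M'(2)] stiefel_mult)
  have "distr M M (\<lambda>v. v ** \<gamma>) = distr (distr H M (\<lambda>g. g ** v0)) M (\<lambda>v. v ** \<gamma>)"
    by (simp add: right_haar_orbit(2)[OF M H v0])
  also have "\<dots> = distr H M (\<lambda>g. g ** (v0 ** \<gamma>))"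
    by (subst distr_distr[OF * right_haar_orbit(1)[OF M H v0]]) (simp add: comp_def matrix_mul_assoc)
  also have "\<dots> = M"
    by (intro right_haar_orbit(2)[OF M H] stiefel_mult v0 \<gamma>')
  finally show "distr M M (\<lambda>v. v ** \<gamma>) = M" .
qed

section \<open>Block frames and the Funk transform\<close>

definition top_frame :: "real^'l^('l::finite + 'k::finite)" where
  "top_frame = vblock (mat 1) 0"

definition bottom_frame :: "real^'k^('l::finite + 'k::finite)" where
  "bottom_frame = vblock 0 (mat 1)"

lemma vblock_top: "vblock \<omega> 0 = top_frame ** \<omega>"
  by (simp add: top_frame_def vblock_def vec_eq_iff matrix_matrix_mult_def mat_def if_distrib
      if_distribR cong: if_cong split: sum.split)

lemma sum_UNIV_Plus:
  fixes F :: "'l::finite + 'k::finite \<Rightarrow> 'a::comm_monoid_add"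
  shows "(\<Sum>i\<in>UNIV. F i) = (\<Sum>i\<in>UNIV. F (Inl i)) + (\<Sum>j\<in>UNIV. F (Inr j))"
  using sum.Plus[of "UNIV :: 'l set" "UNIV :: 'k set" F] by (simp add: comp_def)

lemma gram_vblock:
  "transpose (vblock A B) ** vblock C D = transpose A ** C + transpose B ** (D :: real^'p^'k::finite)"
  by (simp add: vec_eq_iff matrix_matrix_mult_def transpose_def vblock_def sum_UNIV_Plus)

lemma transpose_zero [simp]: "transpose 0 = 0"
  by (simp add: transpose_def vec_eq_iff)

lemma frame_grams:
  "transpose top_frame ** top_frame = mat 1" "transpose bottom_frame ** bottom_frame = mat 1"
  "transpose top_frame ** bottom_frame = 0" "transpose bottom_frame ** top_frame = 0"
  by (simp_all add: top_frame_def bottom_frame_def gram_vblock)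

lemma frames_in_stiefel: "top_frame \<in> stiefel" "bottom_frame \<in> stiefel"
  by (simp_all add: stiefel_def frame_grams)

lemma frames_complete:
  "top_frame ** transpose top_frame + bottom_frame ** transpose bottom_frame = mat 1"
  by (auto simp: vec_eq_iff matrix_matrix_mult_def transpose_def top_frame_def bottom_frame_def vblock_def
      mat_def if_distrib if_distribR cong: if_cong split: sum.split)

lemma frame_completion:
  assumes "u \<in> stiefel"
  shows "orthogonal_matrix (frame_completion u)" "frame_completion u ** bottom_frame = u"
proof -
  have "align bottom_frame u ** bottom_frame = u"
    using assms by (intro align_mult) (simp add: stiefel_def frame_grams)
  then have "\<exists>g. orthogonal_matrix g \<and> g ** vblock 0 (mat 1) = u"
    using orthogonal_matrix_align unfolding bottom_frame_def by blast
  from someI_ex[OF this] show "orthogonal_matrix (frame_completion u)" "frame_completion u ** bottom_frame = u"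
    unfolding frame_completion_def bottom_frame_def by auto
qed

lemma matrix_add_rdistrib: "(A + B) ** C = A ** C + B ** (C :: real^'p^'q)"
  by (simp add: matrix_matrix_mult_def vec_eq_iff sum.distrib distrib_right)

lemma matrix_diff_rdistrib: "(A - B) ** C = A ** C - B ** (C :: real^'p^'q)"
  by (simp add: matrix_matrix_mult_def vec_eq_iff sum_subtractf left_diff_distrib)

lemma matrix_diff_ldistrib: "(C :: real^'p^'q) ** (A - B) = C ** A - C ** B"
  by (simp add: matrix_matrix_mult_def vec_eq_iff sum_subtractf right_diff_distrib)

lemma transpose_diff: "transpose (A - B) = transpose A - transpose (B :: real^'p^'q)"
  by (simp add: transpose_def vec_eq_iff)

text \<open>
  Two rotations that agree on the bottom frame differ by a rotation of its orthogonal complement.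
  This is why the Funk transform does not depend on the choice of \<open>frame_completion\<close>.
\<close>

lemma fiber_rotation:
  fixes g h :: "real^('l::finite + 'k::finite)^('l + 'k)"
  assumes g: "orthogonal_matrix g" and h: "orthogonal_matrix h"
    and eq: "g ** (bottom_frame :: real^'k^('l + 'k)) = h ** bottom_frame"
  obtains s :: "real^'l^'l" where "orthogonal_matrix s" "g ** top_frame = h ** (top_frame ** s)"
proof
  let ?E = "top_frame :: real^'l^('l + 'k)" and ?U = "bottom_frame :: real^'k^('l + 'k)"
  define s where "s = transpose (h ** ?E) ** (g ** ?E)"
  have "transpose (h ** ?U) ** (g ** ?E) = 0"
    using gram_orthogonal_mult[OF g, of ?U ?E] by (simp add: frame_grams flip: eq)
  then have U: "transpose ?U ** (transpose h ** (g ** ?E)) = 0"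
    by (simp add: matrix_transpose_mul matrix_mul_assoc)
  have "transpose h ** (g ** ?E) = (?E ** transpose ?E + ?U ** transpose ?U) ** (transpose h ** (g ** ?E))"
    by (simp add: frames_complete)
  also have "\<dots> = ?E ** s"
    by (simp add: matrix_add_rdistrib s_def matrix_transpose_mul U flip: matrix_mul_assoc)
  finally have "h ** (transpose h ** (g ** ?E)) = h ** (?E ** s)"
    by simp
  then show eq': "g ** ?E = h ** (?E ** s)"
    by (simp add: orthogonal_matrixD(4)[OF h])
  have "transpose s ** s = transpose (h ** (?E ** s)) ** (h ** (?E ** s))"
    by (simp only: gram_orthogonal_mult[OF h])
      (simp add: matrix_transpose_mul frame_grams matrix_mul_assoc, simp add: frame_grams flip: matrix_mul_assoc)
  also have "\<dots> = mat 1"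
    unfolding eq'[symmetric] by (simp add: gram_orthogonal_mult[OF g] frame_grams)
  finally show "orthogonal_matrix s"
    by (simp add: orthogonal_matrix)
qed

text \<open>
  The measure \<open>H\<close> is an auxiliary choice: it turns every integral against \<open>\<mu>\<close>, \<open>\<sigma>\<close> or over the
  incidence relation into an average over rotations of one fixed frame.
\<close>

locale funk_setting =
  fixes \<mu> :: "(real^'m^('l::finite + 'k::finite)) measure"
    and \<sigma> :: "(real^'k^('l::finite + 'k::finite)) measure"
    and \<nu> :: "(real^'m^'l) measure"
    and \<eta> :: "(real^'m^'m) measure"
    and H :: "(real^('l::finite + 'k::finite)^('l::finite + 'k::finite)) measure"
  assumes mu: "invariant_prob stiefel \<mu>"
    and sigma: "invariant_prob stiefel \<sigma>"
    and nu: "invariant_prob stiefel \<nu>"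
    and eta: "invariant_prob {\<gamma>. orthogonal_matrix \<gamma>} \<eta>"
    and haar: "right_haar H"
begin

sublocale mu: prob_space \<mu> using invariant_probD(1)[OF mu] .
sublocale sigma: prob_space \<sigma> using invariant_probD(1)[OF sigma] .
sublocale nu: prob_space \<nu> using invariant_probD(1)[OF nu] .
sublocale eta: prob_space \<eta> using invariant_probD(1)[OF eta] .
sublocale haar: prob_space H using right_haarD(1)[OF haar] .
sublocale haar_nu: pair_prob_space H \<nu> ..
sublocale sigma_nu: pair_prob_space \<sigma> \<nu> ..
sublocale nu_eta: pair_prob_space \<nu> \<eta> ..
sublocale mu_eta: pair_prob_space \<mu> \<eta> ..

lemma eta_stiefel: "invariant_prob stiefel \<eta>"
  using eta by (simp add: stiefel_orthogonal)

lemmas mu_sets = invariant_probD(2)[OF mu] and mu_space = invariant_probD(3)[OF mu]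
lemmas sigma_sets = invariant_probD(2)[OF sigma] and sigma_space = invariant_probD(3)[OF sigma]
lemmas nu_sets = invariant_probD(2)[OF nu] and nu_space = invariant_probD(3)[OF nu]
lemmas eta_sets = invariant_probD(2)[OF eta_stiefel] and eta_space = invariant_probD(3)[OF eta_stiefel]
lemmas haar_sets = right_haarD(2)[OF haar] and haar_space = right_haarD(3)[OF haar]

definition embed :: "real^('l + 'k)^('l + 'k) \<Rightarrow> real^'m^'l \<Rightarrow> real^'m^('l + 'k)" where
  "embed g \<omega> = g ** (top_frame ** \<omega>)"

lemma embed_stiefel: "orthogonal_matrix g \<Longrightarrow> \<omega> \<in> stiefel \<Longrightarrow> embed g \<omega> \<in> stiefel"
  by (simp add: embed_def stiefel_mult_left stiefel_mult frames_in_stiefel)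

lemma measurable_embed_fiber: "orthogonal_matrix g \<Longrightarrow> embed g \<in> \<nu> \<rightarrow>\<^sub>M \<mu>"
  using measurable_restricted_id[OF nu_sets] nu_space
  by (auto simp: measurable_restricted_iff[OF mu_sets] embed_stiefel embed_def[abs_def] simp del: embed_def
      intro!: embed_stiefel[unfolded embed_def])

lemma embed_fiber_distr:
  assumes g: "orthogonal_matrix g" and h: "orthogonal_matrix h"
    and eq: "g ** bottom_frame = h ** (bottom_frame :: real^'k^('l + 'k))"
  shows "distr \<nu> \<mu> (embed g) = distr \<nu> \<mu> (embed h)"
proof -
  obtain s :: "real^'l^'l" where s: "orthogonal_matrix s" "g ** top_frame = h ** (top_frame ** s)"
    using fiber_rotation[OF g h eq] .
  have "embed g = embed h \<circ> (\<lambda>\<omega>. s ** \<omega>)"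
    by (simp add: fun_eq_iff embed_def matrix_mul_assoc s(2))
  then have "distr \<nu> \<mu> (embed g) = distr (distr \<nu> \<nu> (\<lambda>\<omega>. s ** \<omega>)) \<mu> (embed h)"
    using distr_distr[OF measurable_embed_fiber[OF h] measurable_mult_left[OF nu_sets s(1)]] by simp
  then show ?thesis
    by (simp add: invariant_probD(4)[OF nu s(1)])
qed

lemma funk_eq:
  assumes f: "f \<in> borel_measurable \<mu>" and g: "orthogonal_matrix g"
  shows "funk \<nu> f (g ** bottom_frame) = (\<integral>\<omega>. f (embed g \<omega>) \<partial>\<nu>)"
proof -
  let ?u = "g ** (bottom_frame :: real^'k^('l + 'k))"
  have u: "?u \<in> stiefel"
    by (simp add: stiefel_mult_left g frames_in_stiefel)
  note h = frame_completion[OF u]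
  have "funk \<nu> f ?u = (\<integral>\<omega>. f (embed (frame_completion ?u) \<omega>) \<partial>\<nu>)"
    by (simp add: funk_def vblock_top embed_def)
  also have "\<dots> = (\<integral>v. f v \<partial>distr \<nu> \<mu> (embed (frame_completion ?u)))"
    by (rule integral_distr[symmetric]) (use h measurable_embed_fiber f in auto)
  also have "\<dots> = (\<integral>v. f v \<partial>distr \<nu> \<mu> (embed g))"
    using embed_fiber_distr[OF h(1) g h(2)] by simp
  also have "\<dots> = (\<integral>\<omega>. f (embed g \<omega>) \<partial>\<nu>)"
    by (rule integral_distr) (use g measurable_embed_fiber f in auto)
  finally show ?thesis .
qed

lemma measurable_embed_pair:
  assumes S: "S \<in> N \<rightarrow>\<^sub>M H"
  shows "(\<lambda>(x, \<omega>). embed (S x) \<omega>) \<in> N \<Otimes>\<^sub>M \<nu> \<rightarrow>\<^sub>M \<mu>"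
proof -
  have [measurable]: "S \<in> borel_measurable N" and S': "x \<in> space N \<Longrightarrow> orthogonal_matrix (S x)" for x
    using S measurable_space[OF S] by (auto simp: measurable_restricted_iff[OF haar_sets] haar_space)
  have "(\<lambda>p. snd p) \<in> borel_measurable (N \<Otimes>\<^sub>M \<nu>)"
    by (rule measurable_compose[OF measurable_snd measurable_restricted_id[OF nu_sets]])
  then have "(\<lambda>p. embed (S (fst p)) (snd p)) \<in> borel_measurable (N \<Otimes>\<^sub>M \<nu>)"
    unfolding embed_def by measurable
  then show ?thesis
    using S' embed_stiefel by (auto simp: measurable_restricted_iff[OF mu_sets] space_pair_measure nu_space split_beta)
qed

text \<open>
  Averaging over a fibre and then over all fibres gives back \<open>\<mu>\<close>: for each fixed \<open>\<omega>\<close> the frame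
  \<open>embed g \<omega>\<close> runs through a full orbit.
\<close>

lemma haar_embed: "distr (H \<Otimes>\<^sub>M \<nu>) \<mu> (\<lambda>(g, \<omega>). embed g \<omega>) = \<mu>" (is "distr _ _ ?e = _")
proof (rule measure_eqI)
  fix A assume "A \<in> sets (distr (H \<Otimes>\<^sub>M \<nu>) \<mu> ?e)"
  then have A[measurable]: "A \<in> sets \<mu>"
    by simp
  have [measurable]: "?e \<in> H \<Otimes>\<^sub>M \<nu> \<rightarrow>\<^sub>M \<mu>"
    using measurable_embed_pair[of "\<lambda>g. g"] by simp
  have "emeasure (distr (H \<Otimes>\<^sub>M \<nu>) \<mu> ?e) A = (\<integral>\<^sup>+v. indicator A v \<partial>distr (H \<Otimes>\<^sub>M \<nu>) \<mu> ?e)"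
    by simp
  also have "\<dots> = (\<integral>\<^sup>+p. indicator A (?e p) \<partial>(H \<Otimes>\<^sub>M \<nu>))"
    by (rule nn_integral_distr) measurable
  also have "\<dots> = (\<integral>\<^sup>+\<omega>. \<integral>\<^sup>+g. indicator A (embed g \<omega>) \<partial>H \<partial>\<nu>)"
    by (subst haar_nu.nn_integral_snd[symmetric]) (auto simp: measurable_compose[of ?e])
  also have "\<dots> = (\<integral>\<^sup>+\<omega>. emeasure \<mu> A \<partial>\<nu>)"
  proof (rule nn_integral_cong)
    fix \<omega> assume "\<omega> \<in> space \<nu>"
    then have v: "top_frame ** \<omega> \<in> stiefel"
      by (simp add: nu_space stiefel_mult frames_in_stiefel)
    note orbit = right_haar_orbit[OF mu haar v]
    note orbit(1)[measurable]
    have "emeasure \<mu> A = (\<integral>\<^sup>+v. indicator A v \<partial>distr H \<mu> (\<lambda>g. g ** (top_frame ** \<omega>)))"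
      by (simp add: orbit(2))
    also have "\<dots> = (\<integral>\<^sup>+g. indicator A (embed g \<omega>) \<partial>H)"
      unfolding embed_def by (rule nn_integral_distr) measurable
    finally show "(\<integral>\<^sup>+g. indicator A (embed g \<omega>) \<partial>H) = emeasure \<mu> A" ..
  qed
  also have "\<dots> = emeasure \<mu> A"
    by (simp add: nu.emeasure_space_1)
  finally show "emeasure (distr (H \<Otimes>\<^sub>M \<nu>) \<mu> ?e) A = emeasure \<mu> A" .
qed simp

text \<open>
  The Hilbert choice in \<open>frame_completion\<close> gives no control over the dependence on \<open>u\<close>; this explicit
  completion is measurable in \<open>u\<close>.
\<close>

definition section_of :: "real^'k^('l + 'k) \<Rightarrow> real^('l + 'k)^('l + 'k)" where
  "section_of u = align bottom_frame u"

lemma section_of: "orthogonal_matrix (section_of u)" "u \<in> stiefel \<Longrightarrow> section_of u ** bottom_frame = u"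
  by (auto simp: section_of_def orthogonal_matrix_align stiefel_def frame_grams intro!: align_mult)

lemma measurable_section_of [measurable]: "section_of \<in> \<sigma> \<rightarrow>\<^sub>M H"
  using measurable_compose[OF measurable_restricted_id[OF sigma_sets] borel_measurable_align[of bottom_frame]]
  by (auto simp: measurable_restricted_iff[OF haar_sets] section_of section_of_def[abs_def] orthogonal_matrix_align)

text \<open>
  The same disintegration of \<open>\<mu>\<close> with the fibres indexed by \<open>u\<close>, for which almost every fibre means
  almost every \<open>u\<close> with respect to \<open>\<sigma>\<close>.
\<close>

lemma sigma_embed: "distr (\<sigma> \<Otimes>\<^sub>M \<nu>) \<mu> (\<lambda>(u, \<omega>). embed (section_of u) \<omega>) = \<mu>" (is "distr _ _ ?e = _")
proof (rule measure_eqI)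
  fix A assume "A \<in> sets (distr (\<sigma> \<Otimes>\<^sub>M \<nu>) \<mu> ?e)"
  then have A[measurable]: "A \<in> sets \<mu>"
    by simp
  have e[measurable]: "?e \<in> \<sigma> \<Otimes>\<^sub>M \<nu> \<rightarrow>\<^sub>M \<mu>"
    by (rule measurable_embed_pair) measurable
  have e'[measurable]: "(\<lambda>(g, \<omega>). embed g \<omega>) \<in> H \<Otimes>\<^sub>M \<nu> \<rightarrow>\<^sub>M \<mu>"
    using measurable_embed_pair[of "\<lambda>g. g"] by simp
  note orbit = right_haar_orbit[OF sigma haar frames_in_stiefel(2)]
  note orbit(1)[measurable]
  have ind: "(\<lambda>p. indicator A (?e p) :: ennreal) \<in> borel_measurable (\<sigma> \<Otimes>\<^sub>M \<nu>)"
    by measurable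
  have ind': "(\<lambda>p. indicator A ((\<lambda>(g, \<omega>). embed g \<omega>) p) :: ennreal) \<in> borel_measurable (H \<Otimes>\<^sub>M \<nu>)"
    by measurable
  have fiber: "(\<integral>\<^sup>+\<omega>. indicator A (embed g \<omega>) \<partial>\<nu>) = emeasure (distr \<nu> \<mu> (embed g)) A" if "orthogonal_matrix g" for g
  proof -
    note measurable_embed_fiber[OF that, measurable]
    have "emeasure (distr \<nu> \<mu> (embed g)) A = (\<integral>\<^sup>+v. indicator A v \<partial>distr \<nu> \<mu> (embed g))"
      by simp
    also have "\<dots> = (\<integral>\<^sup>+\<omega>. indicator A (embed g \<omega>) \<partial>\<nu>)"
      by (rule nn_integral_distr) measurable
    finally show ?thesis ..
  qed
  have "emeasure (distr (\<sigma> \<Otimes>\<^sub>M \<nu>) \<mu> ?e) A = (\<integral>\<^sup>+v. indicator A v \<partial>distr (\<sigma> \<Otimes>\<^sub>M \<nu>) \<mu> ?e)"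
    by simp
  also have "\<dots> = (\<integral>\<^sup>+p. indicator A (?e p) \<partial>(\<sigma> \<Otimes>\<^sub>M \<nu>))"
    by (rule nn_integral_distr) measurable
  also have "\<dots> = (\<integral>\<^sup>+u. \<integral>\<^sup>+\<omega>. indicator A (embed (section_of u) \<omega>) \<partial>\<nu> \<partial>\<sigma>)"
    using nu.nn_integral_fst[OF ind] by simp
  also have "\<dots> = (\<integral>\<^sup>+u. (\<integral>\<^sup>+\<omega>. indicator A (embed (section_of u) \<omega>) \<partial>\<nu>) \<partial>distr H \<sigma> (\<lambda>g. g ** bottom_frame))"
    by (simp add: orbit(2))
  also have "\<dots> = (\<integral>\<^sup>+g. (\<integral>\<^sup>+\<omega>. indicator A (embed (section_of (g ** bottom_frame)) \<omega>) \<partial>\<nu>) \<partial>H)"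
    by (rule nn_integral_distr[OF orbit(1)])
      (use nu.borel_measurable_nn_integral_fst[OF ind] in simp)
  also have "\<dots> = (\<integral>\<^sup>+g. (\<integral>\<^sup>+\<omega>. indicator A (embed g \<omega>) \<partial>\<nu>) \<partial>H)"
  proof (rule nn_integral_cong)
    fix g assume "g \<in> space H"
    then have g: "orthogonal_matrix g"
      by (simp add: haar_space)
    then have "g ** (bottom_frame :: real^'k^('l + 'k)) \<in> stiefel"
      by (simp add: stiefel_mult_left frames_in_stiefel)
    then have "distr \<nu> \<mu> (embed (section_of (g ** bottom_frame))) = distr \<nu> \<mu> (embed g)"
      by (intro embed_fiber_distr section_of g)
    then show "(\<integral>\<^sup>+\<omega>. indicator A (embed (section_of (g ** bottom_frame)) \<omega>) \<partial>\<nu>) = (\<integral>\<^sup>+\<omega>. indicator A (embed g \<omega>) \<partial>\<nu>)"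
      by (simp add: fiber g section_of)
  qed
  also have "\<dots> = (\<integral>\<^sup>+p. indicator A ((\<lambda>(g, \<omega>). embed g \<omega>) p) \<partial>(H \<Otimes>\<^sub>M \<nu>))"
    using nu.nn_integral_fst[OF ind'] by simp
  also have "\<dots> = (\<integral>\<^sup>+v. indicator A v \<partial>distr (H \<Otimes>\<^sub>M \<nu>) \<mu> (\<lambda>(g, \<omega>). embed g \<omega>))"
    by (rule nn_integral_distr[symmetric]) measurable
  also have "\<dots> = emeasure \<mu> A"
    by (simp add: haar_embed)
  finally show "emeasure (distr (\<sigma> \<Otimes>\<^sub>M \<nu>) \<mu> ?e) A = emeasure \<mu> A" .
qed simp

lemma mu_right: "distr (\<mu> \<Otimes>\<^sub>M \<eta>) \<mu> (\<lambda>(v, \<gamma>). v ** \<gamma>) = \<mu>" (is "distr _ _ ?e = _")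
  and measurable_mu_right: "(\<lambda>(v, \<gamma>). v ** \<gamma>) \<in> \<mu> \<Otimes>\<^sub>M \<eta> \<rightarrow>\<^sub>M \<mu>"
proof -
  show e[measurable]: "?e \<in> \<mu> \<Otimes>\<^sub>M \<eta> \<rightarrow>\<^sub>M \<mu>"
    by (rule measurable_mult_pair[OF mu_sets eta_sets mu_sets]) (rule stiefel_mult)
  show "distr (\<mu> \<Otimes>\<^sub>M \<eta>) \<mu> ?e = \<mu>"
  proof (rule measure_eqI)
    fix A assume "A \<in> sets (distr (\<mu> \<Otimes>\<^sub>M \<eta>) \<mu> ?e)"
    then have A[measurable]: "A \<in> sets \<mu>"
      by simp
    have "emeasure (distr (\<mu> \<Otimes>\<^sub>M \<eta>) \<mu> ?e) A = (\<integral>\<^sup>+v. indicator A v \<partial>distr (\<mu> \<Otimes>\<^sub>M \<eta>) \<mu> ?e)"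
      by simp
    also have "\<dots> = (\<integral>\<^sup>+p. indicator A (?e p) \<partial>(\<mu> \<Otimes>\<^sub>M \<eta>))"
      by (rule nn_integral_distr) measurable
    also have "\<dots> = (\<integral>\<^sup>+\<gamma>. \<integral>\<^sup>+v. indicator A (v ** \<gamma>) \<partial>\<mu> \<partial>\<eta>)"
      by (subst mu_eta.nn_integral_snd[symmetric]) (auto simp: measurable_compose[of ?e])
    also have "\<dots> = (\<integral>\<^sup>+\<gamma>. emeasure \<mu> A \<partial>\<eta>)"
    proof (rule nn_integral_cong)
      fix \<gamma> assume "\<gamma> \<in> space \<eta>"
      then have "orthogonal_matrix \<gamma>"
        by (simp add: eta_space stiefel_orthogonal)
      note right = invariant_prob_right[OF mu this]
      note right(1)[measurable]
      have "emeasure \<mu> A = (\<integral>\<^sup>+v. indicator A v \<partial>distr \<mu> \<mu> (\<lambda>v. v ** \<gamma>))"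
        by (simp add: right(2))
      also have "\<dots> = (\<integral>\<^sup>+v. indicator A (v ** \<gamma>) \<partial>\<mu>)"
        by (rule nn_integral_distr) measurable
      finally show "(\<integral>\<^sup>+v. indicator A (v ** \<gamma>) \<partial>\<mu>) = emeasure \<mu> A" ..
    qed
    also have "\<dots> = emeasure \<mu> A"
      by (simp add: eta.emeasure_space_1)
    finally show "emeasure (distr (\<mu> \<Otimes>\<^sub>M \<eta>) \<mu> ?e) A = emeasure \<mu> A" .
  qed simp
qed

end

section \<open>Bounded kernels and moments\<close>

lemma integrable_bounded_scaleR:
  fixes \<phi> :: "'a \<Rightarrow> 'c::{banach, second_countable_topology}"
  assumes \<phi>: "integrable M \<phi>" and K: "K \<in> borel_measurable M"
    and bound: "\<And>x. x \<in> space M \<Longrightarrow> \<bar>K x\<bar> \<le> C"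
  shows "integrable M (\<lambda>x. K x *\<^sub>R \<phi> x)"
proof (rule Bochner_Integration.integrable_bound)
  show "integrable M (\<lambda>x. C * norm (\<phi> x))"
    using \<phi> by simp
  show "(\<lambda>x. K x *\<^sub>R \<phi> x) \<in> borel_measurable M"
    using K borel_measurable_integrable[OF \<phi>] by measurable
  show "AE x in M. norm (K x *\<^sub>R \<phi> x) \<le> norm (C * norm (\<phi> x))"
  proof (rule AE_I2)
    fix x assume "x \<in> space M"
    then have "\<bar>K x\<bar> * norm (\<phi> x) \<le> \<bar>C\<bar> * norm (\<phi> x)"
      using bound[of x] by (intro mult_right_mono) auto
    then show "norm (K x *\<^sub>R \<phi> x) \<le> norm (C * norm (\<phi> x))"
      by (simp add: abs_mult)
  qed
qed

lemma norm_integral_bounded_scaleR: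
  fixes \<phi> :: "'a \<Rightarrow> 'c::{banach, second_countable_topology}"
  assumes \<phi>: "integrable M \<phi>" and K: "K \<in> borel_measurable M"
    and bound: "\<And>x. x \<in> space M \<Longrightarrow> \<bar>K x\<bar> \<le> C"
  shows "norm (\<integral>x. K x *\<^sub>R \<phi> x \<partial>M) \<le> C * (\<integral>x. norm (\<phi> x) \<partial>M)"
proof -
  have "norm (\<integral>x. K x *\<^sub>R \<phi> x \<partial>M) \<le> (\<integral>x. norm (K x *\<^sub>R \<phi> x) \<partial>M)"
    by (rule integral_norm_bound)
  also have "\<dots> \<le> (\<integral>x. C * norm (\<phi> x) \<partial>M)"
    using integrable_bounded_scaleR[OF \<phi> K bound] \<phi> bound
    by (intro integral_mono integrable_norm) (auto intro!: mult_right_mono)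
  finally show ?thesis
    by simp
qed

lemma integrable_pair_bounded_kernel:
  fixes \<phi> :: "'a \<Rightarrow> 'c::{banach, second_countable_topology}" and K :: "'a \<times> 'b \<Rightarrow> real"
  assumes M2: "finite_measure M2"
    and \<phi>: "integrable M1 \<phi>" and K: "K \<in> borel_measurable (M1 \<Otimes>\<^sub>M M2)"
    and bound: "\<And>x y. x \<in> space M1 \<Longrightarrow> y \<in> space M2 \<Longrightarrow> \<bar>K (x, y)\<bar> \<le> C"
  shows "integrable (M1 \<Otimes>\<^sub>M M2) (\<lambda>(x, y). K (x, y) *\<^sub>R \<phi> x)"
proof (rule integrableI_bounded)
  interpret M2: finite_measure M2 by (rule M2)
  note [measurable] = K borel_measurable_integrable[OF \<phi>]
  have meas: "(\<lambda>p. K p *\<^sub>R \<phi> (fst p)) \<in> borel_measurable (M1 \<Otimes>\<^sub>M M2)"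
    by measurable
  then show "(\<lambda>(x, y). K (x, y) *\<^sub>R \<phi> x) \<in> borel_measurable (M1 \<Otimes>\<^sub>M M2)"
    by (simp add: split_beta')
  have "(\<integral>\<^sup>+p. norm (case p of (x, y) \<Rightarrow> K (x, y) *\<^sub>R \<phi> x) \<partial>(M1 \<Otimes>\<^sub>M M2))
      \<le> (\<integral>\<^sup>+p. ennreal C * ennreal (norm (\<phi> (fst p))) \<partial>(M1 \<Otimes>\<^sub>M M2))"
    using bound by (intro nn_integral_mono)
      (auto simp: space_pair_measure ennreal_mult intro!: ennreal_leI mult_right_mono)
  also have "\<dots> = (\<integral>\<^sup>+x. \<integral>\<^sup>+y. ennreal C * ennreal (norm (\<phi> x)) \<partial>M2 \<partial>M1)"
    by (subst M2.nn_integral_fst[symmetric]) auto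
  also have "\<dots> = (\<integral>\<^sup>+x. (ennreal C * emeasure M2 (space M2)) * ennreal (norm (\<phi> x)) \<partial>M1)"
    by (simp add: mult_ac)
  also have "\<dots> = (ennreal C * emeasure M2 (space M2)) * (\<integral>\<^sup>+x. ennreal (norm (\<phi> x)) \<partial>M1)"
    by (rule nn_integral_cmult) measurable
  also have "\<dots> < \<infinity>"
  proof -
    have "emeasure M2 (space M2) < \<top>"
      by (metis M2.emeasure_finite infinity_ennreal_def top.not_eq_extremum)
    then show ?thesis
      using \<phi> by (simp add: integrable_iff_bounded ennreal_mult_less_top)
  qed
  finally show "(\<integral>\<^sup>+p. norm (case p of (x, y) \<Rightarrow> K (x, y) *\<^sub>R \<phi> x) \<partial>(M1 \<Otimes>\<^sub>M M2)) < \<infinity>" .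
qed

text \<open>
  The boundedness of the kernel makes the double integral absolutely convergent, so this is an
  instance of Fubini's theorem.
\<close>

lemma integral_bounded_kernel_swap:
  fixes \<phi> :: "'a \<Rightarrow> 'c::{banach, second_countable_topology}" and K :: "'a \<Rightarrow> 'b \<Rightarrow> real"
  assumes M1: "finite_measure M1" and M2: "finite_measure M2"
    and \<phi>: "integrable M1 \<phi>" and K: "(\<lambda>(x, y). K x y) \<in> borel_measurable (M1 \<Otimes>\<^sub>M M2)"
    and bound: "\<And>x y. x \<in> space M1 \<Longrightarrow> y \<in> space M2 \<Longrightarrow> \<bar>K x y\<bar> \<le> C"
  shows "(\<integral>y. (\<integral>x. K x y *\<^sub>R \<phi> x \<partial>M1) \<partial>M2) = (\<integral>x. (\<integral>y. K x y \<partial>M2) *\<^sub>R \<phi> x \<partial>M1)"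
proof -
  interpret M1: finite_measure M1 by (rule M1)
  interpret M2: finite_measure M2 by (rule M2)
  interpret pair_sigma_finite M1 M2 ..
  have "integrable (M1 \<Otimes>\<^sub>M M2) (\<lambda>(x, y). K x y *\<^sub>R \<phi> x)"
    using integrable_pair_bounded_kernel[OF M2 \<phi> K, of C] bound by simp
  then have "(\<integral>y. (\<integral>x. K x y *\<^sub>R \<phi> x \<partial>M1) \<partial>M2) = (\<integral>x. (\<integral>y. K x y *\<^sub>R \<phi> x \<partial>M2) \<partial>M1)"
    by (rule Fubini_integral)
  also have "\<dots> = (\<integral>x. (\<integral>y. K x y \<partial>M2) *\<^sub>R \<phi> x \<partial>M1)"
  proof (rule Bochner_Integration.integral_cong[OF refl])
    fix x assume x: "x \<in> space M1"
    have "(\<lambda>y. K x y) \<in> borel_measurable M2"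
      using measurable_compose[OF measurable_Pair1'[OF x] K] by simp
    then have "integrable M2 (\<lambda>y. K x y)"
      using bound x by (intro M2.integrable_const_bound[where B = C] AE_I2) auto
    then show "(\<integral>y. K x y *\<^sub>R \<phi> x \<partial>M2) = (\<integral>y. K x y \<partial>M2) *\<^sub>R \<phi> x"
      by simp
  qed
  finally show ?thesis .
qed

text \<open>
  A reflection carries \<open>a\<close> to a multiple of a basis vector, so the moment depends on the length of
  \<open>a\<close> only, and homogeneity determines how.  The constant is an integral of a nonnegative function
  which is positive on a nonempty open set.
\<close>

lemma ball_moment:
  fixes d :: nat
  obtains c :: real where "c \<noteq> 0"
    "\<And>a::'a::euclidean_space. (\<integral>y. (y \<bullet> a) ^ (2 * d) \<partial>restrict_space lborel (ball 0 1)) = c * norm a ^ (2 * d)"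
proof -
  define U where "U = restrict_space lborel (ball (0::'a) 1)"
  have int_U: "(\<integral>y. F y \<partial>U) = (\<integral>y. indicator (ball 0 1) y * F y \<partial>lborel)" for F :: "'a \<Rightarrow> real"
    unfolding U_def by (subst integral_restrict_space) auto
  obtain e :: 'a where e: "e \<in> Basis"
    using nonempty_Basis by blast
  define c where "c = (\<integral>y. (y \<bullet> e) ^ (2 * d) \<partial>U)"
  have moment: "(\<integral>y. (y \<bullet> a) ^ (2 * d) \<partial>U) = c * norm a ^ (2 * d)" for a :: 'a
  proof -
    define T where "T = reflect (norm a *\<^sub>R e - a)"
    have T: "orthogonal_transformation T"
      unfolding T_def by (rule orthogonal_transformation_reflect)
    have Te: "T (norm a *\<^sub>R e) = a"
      unfolding T_def using e by (intro reflect_swap) simp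
    have [measurable]: "T \<in> borel_measurable borel"
      using orthogonal_transformation_linear[OF T]
      by (intro borel_measurable_continuous_onI linear_continuous_on) (simp add: linear_linear)
    have "(\<integral>y. (y \<bullet> a) ^ (2 * d) \<partial>U)
        = (\<integral>y. indicator (ball 0 1) y * (y \<bullet> a) ^ (2 * d) \<partial>distr lborel borel T)"
      by (simp add: int_U lborel_distr_orthogonal_transformation[OF T])
    also have "\<dots> = (\<integral>y. indicator (ball 0 1) (T y) * (T y \<bullet> a) ^ (2 * d) \<partial>lborel)"
      by (rule integral_distr)
        (auto intro!: borel_measurable_times borel_measurable_indicator borel_measurable_power borel_measurable_inner)
    also have "\<dots> = (\<integral>y. indicator (ball 0 1) y * (y \<bullet> (norm a *\<^sub>R e)) ^ (2 * d) \<partial>lborel)"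
    proof (rule Bochner_Integration.integral_cong[OF refl])
      fix y
      have "T y \<bullet> a = y \<bullet> (norm a *\<^sub>R e)"
        using T Te unfolding orthogonal_transformation_def by metis
      then show "indicator (ball 0 1) (T y) * (T y \<bullet> a) ^ (2 * d)
          = indicator (ball 0 1) y * (y \<bullet> (norm a *\<^sub>R e)) ^ (2 * d)"
        by (simp add: indicator_def orthogonal_transformation_norm[OF T])
    qed
    also have "\<dots> = (\<integral>y. (y \<bullet> e) ^ (2 * d) * norm a ^ (2 * d) \<partial>U)"
      unfolding int_U by (rule Bochner_Integration.integral_cong) (simp_all add: power_mult_distrib mult_ac)
    also have "\<dots> = c * norm a ^ (2 * d)"
      by (simp add: c_def)
    finally show ?thesis .
  qed
  have "finite_measure U"
    unfolding U_def using emeasure_lborel_ball_finite[of "0::'a" 1]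
    by (intro finite_measureI) (simp add: space_restrict_space emeasure_restrict_space)
  then interpret U: finite_measure U .
  have integrable: "integrable U (\<lambda>y. (y \<bullet> e) ^ (2 * d))"
  proof (rule U.integrable_const_bound[where B = 1])
    have "\<bar>y \<bullet> e\<bar> \<le> 1" if "y \<in> ball 0 1" for y
      using Basis_le_norm[OF e, of y] that by simp
    then show "AE y in U. norm ((y \<bullet> e) ^ (2 * d)) \<le> 1"
      by (intro AE_I2) (auto simp: U_def space_restrict_space power_abs power_le_one)
    show "(\<lambda>y. (y \<bullet> e) ^ (2 * d)) \<in> borel_measurable U"
      unfolding U_def by (intro measurable_restrict_space1) measurable
  qed
  have "c \<noteq> 0"
  proof
    assume "c = 0"
    then have "AE y in U. (y \<bullet> e) ^ (2 * d) = 0"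
      using integral_nonneg_eq_0_iff_AE[OF integrable] by (simp add: c_def power_mult)
    then have "AE y in lborel. y \<in> ball 0 1 \<longrightarrow> y \<bullet> e = 0"
      unfolding U_def by (subst (asm) AE_restrict_space_iff) auto
    moreover define W where "W = {y::'a. norm y < 1 \<and> y \<bullet> e \<noteq> 0}"
    ultimately have "AE y in lborel. y \<notin> W"
      by (auto simp: W_def elim!: AE_mp)
    moreover have "open W"
      unfolding W_def by (intro open_Collect_conj open_Collect_less open_Collect_neq continuous_intros)
    ultimately have "emeasure lborel W = 0"
      by (simp add: AE_iff_null_sets[symmetric] null_setsD1)
    moreover have "(1/2) *\<^sub>R e \<in> W"
      using e by (simp add: W_def)
    ultimately show False
      using emeasure_lborel_open_nonzero[OF \<open>open W\<close>] by blast
  qed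
  with moment show ?thesis
    using that unfolding U_def by blast
qed

section \<open>Moments annihilated by the kernel of the Funk transform\<close>

text \<open>
  The span of the \<open>k\<close> columns of \<open>y\<close> has dimension at most \<open>k\<close>, so it embeds isometrically into
  \<open>k\<close>-dimensional space; the images of the columns of \<open>y\<close> form \<open>r\<close>.
\<close>

lemma gram_factor:
  fixes y :: "real^'k^'n"
  obtains r :: "real^'k^'k" where "transpose r ** r = transpose y ** y"
proof -
  have "dim (span (columns y)) \<le> card (columns y)"
    by (simp add: dim_le_card' columns_def full_SetCompr_eq)
  also have "card (columns y) \<le> CARD('k)"
    unfolding columns_def using card_image_le[of UNIV "\<lambda>i. column i y"] by (simp add: full_SetCompr_eq)
  finally have dim: "dim (span (columns y)) \<le> dim (UNIV :: (real^'k) set)"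
    by simp
  obtain f :: "real^'n \<Rightarrow> real^'k" where f: "linear f" "\<And>x. x \<in> span (columns y) \<Longrightarrow> norm (f x) = norm x"
    using isometry_subset_subspace[OF subspace_span subspace_UNIV dim] by metis
  have inner: "f x \<bullet> f z = x \<bullet> z" if "x \<in> span (columns y)" "z \<in> span (columns y)" for x z
    using f(2)[of x] f(2)[of z] f(2)[of "x + z"] that
    by (simp add: span_add linear_add[OF f(1)] dot_norm)
  define r where "r = (\<chi> i j. f (column j y) $ i)"
  have "column j r = f (column j y)" for j
    by (simp add: r_def column_def)
  moreover have "column j y \<in> span (columns y)" for j
    by (rule span_base) (auto simp: columns_def)
  ultimately have "transpose r ** r = transpose y ** y"
    by (simp add: matrix_mult_transpose_dot_column inner)
  then show ?thesis
    by (rule that)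
qed

lemma norm_orthogonal_component:
  assumes "v \<in> stiefel"
  shows "norm (b - v ** (transpose v ** b)) \<le> norm (b :: real^'k^'n)"
proof -
  let ?p = "v ** (transpose v ** b)"
  have v: "transpose v ** v = mat 1"
    using assms by (simp add: stiefel_def)
  have "transpose v ** (b - ?p) = 0"
    by (simp add: matrix_mul_assoc v matrix_diff_ldistrib)
  then have "?p \<bullet> (b - ?p) = 0"
    by (simp add: inner_matrix_mult_left)
  then have "b \<bullet> b = (b - ?p) \<bullet> (b - ?p) + ?p \<bullet> ?p"
    by (simp add: inner_diff_left inner_diff_right inner_commute)
  then have "(b - ?p) \<bullet> (b - ?p) \<le> b \<bullet> b"
    by simp
  then show ?thesis
    by (simp add: norm_le)
qed

context funk_setting
begin

lemma haar_integral_right: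
  fixes F :: "_ \<Rightarrow> 'c::{banach, second_countable_topology}"
  assumes "F \<in> borel_measurable H" "orthogonal_matrix h"
  shows "(\<integral>g. F (g ** h) \<partial>H) = (\<integral>g. F g \<partial>H)"
proof -
  have "(\<integral>g. F g \<partial>distr H H (\<lambda>g. g ** h)) = (\<integral>g. F (g ** h) \<partial>H)"
    by (rule integral_distr) (use assms right_haarD(5)[OF haar] in auto)
  then show ?thesis
    by (simp add: right_haarD(4)[OF haar assms(2)])
qed

lemma haar_orbit_integrable:
  fixes f :: "_ \<Rightarrow> 'c::{banach, second_countable_topology}"
  assumes "integrable \<mu> f" "v \<in> stiefel"
  shows "integrable H (\<lambda>g. f (g ** v))"
proof -
  note orbit = right_haar_orbit[OF mu haar assms(2)]
  have "integrable (distr H \<mu> (\<lambda>g. g ** v)) f"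
    using assms(1) by (simp add: orbit(2))
  then show ?thesis
    by (rule integrable_distr[OF orbit(1)])
qed

lemma haar_orbit_integral:
  fixes f :: "_ \<Rightarrow> 'c::{banach, second_countable_topology}"
  assumes "f \<in> borel_measurable \<mu>" "v \<in> stiefel"
  shows "(\<integral>g. f (g ** v) \<partial>H) = (\<integral>v. f v \<partial>\<mu>)"
proof -
  note orbit = right_haar_orbit[OF mu haar assms(2)]
  have "(\<integral>v. f v \<partial>distr H \<mu> (\<lambda>g. g ** v)) = (\<integral>g. f (g ** v) \<partial>H)"
    by (rule integral_distr) (use orbit assms in auto)
  then show ?thesis
    by (simp add: orbit(2))
qed

lemma measurable_haar_id: "(\<lambda>g. g) \<in> borel_measurable H"
  by (rule measurable_restricted_id[OF haar_sets])

text \<open>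
  The integral over \<open>g\<close> does not change when \<open>\<omega>0\<close> is replaced by another \<open>\<omega>\<close>, because some rotation
  moves one frame to the other and fixes the bottom frame.  Averaging over \<open>\<omega>\<close> therefore keeps the
  value, and the integral over \<open>\<omega>\<close> is the Funk transform at \<open>g ** bottom_frame\<close>.
\<close>

lemma funk_zero_pairing:
  fixes f :: "real^'m^('l + 'k) \<Rightarrow> complex" and \<Psi> :: "real^'k^('l + 'k) \<Rightarrow> real"
  assumes f: "integrable \<mu> f" and zero: "AE u in \<sigma>. funk \<nu> f u = 0"
    and \<omega>0: "\<omega>0 \<in> stiefel"
    and \<Psi>: "\<Psi> \<in> borel_measurable borel" and bound: "\<And>u. u \<in> stiefel \<Longrightarrow> \<bar>\<Psi> u\<bar> \<le> C"
  shows "(\<integral>g. \<Psi> (g ** bottom_frame) *\<^sub>R f (g ** (top_frame ** \<omega>0)) \<partial>H) = 0"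
proof -
  let ?U = "bottom_frame :: real^'k^('l + 'k)"
  note [measurable] = borel_measurable_integrable[OF f] measurable_haar_id \<Psi>
  have e[measurable]: "(\<lambda>(g, \<omega>). embed g \<omega>) \<in> H \<Otimes>\<^sub>M \<nu> \<rightarrow>\<^sub>M \<mu>"
    using measurable_embed_pair[of "\<lambda>g. g"] by simp
  have "integrable (distr (H \<Otimes>\<^sub>M \<nu>) \<mu> (\<lambda>(g, \<omega>). embed g \<omega>)) f"
    using f by (simp add: haar_embed)
  then have fe: "integrable (H \<Otimes>\<^sub>M \<nu>) (\<lambda>p. f (embed (fst p) (snd p)))"
    by (simp add: integrable_distr_eq split_beta')
  have stiefel_U: "g ** ?U \<in> stiefel" if "g \<in> space H" for g
    using that by (simp add: haar_space stiefel_mult_left frames_in_stiefel)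
  have "integrable (H \<Otimes>\<^sub>M \<nu>) (\<lambda>p. \<Psi> (fst p ** ?U) *\<^sub>R f (embed (fst p) (snd p)))"
    by (rule integrable_bounded_scaleR[OF fe, where C = C])
      (auto simp: space_pair_measure intro!: bound stiefel_U)
  then have int: "integrable (H \<Otimes>\<^sub>M \<nu>) (\<lambda>(g, \<omega>). \<Psi> (g ** ?U) *\<^sub>R f (embed g \<omega>))"
    by (simp add: split_beta')
  let ?I = "\<integral>g. \<Psi> (g ** ?U) *\<^sub>R f (g ** (top_frame ** \<omega>0)) \<partial>H"
  have "?I = (\<integral>\<omega>. ?I \<partial>\<nu>)"
    by (simp add: nu.prob_space)
  also have "\<dots> = (\<integral>\<omega>. (\<integral>g. \<Psi> (g ** ?U) *\<^sub>R f (embed g \<omega>) \<partial>H) \<partial>\<nu>)"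
  proof (rule Bochner_Integration.integral_cong[OF refl])
    fix \<omega> assume "\<omega> \<in> space \<nu>"
    then have \<omega>: "\<omega> \<in> stiefel"
      by (simp add: nu_space)
    obtain t where t: "orthogonal_matrix t" "t ** (top_frame ** \<omega>0) = top_frame ** \<omega>" "t ** ?U = ?U"
    proof (rule align_pair[of "top_frame ** \<omega>0" "top_frame ** \<omega>" ?U ?U])
      have "top_frame ** \<omega>0 \<in> stiefel" "(top_frame :: real^'l^('l + 'k)) ** \<omega> \<in> stiefel"
        using \<omega>0 \<omega> by (simp_all add: stiefel_mult frames_in_stiefel)
      then show "transpose (top_frame ** \<omega>0) ** (top_frame ** \<omega>0) = transpose (top_frame ** \<omega>) ** ((top_frame :: real^'l^('l + 'k)) ** \<omega>)"
        by (simp add: stiefel_def)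
      show "transpose (top_frame ** \<omega>0) ** ?U = transpose (top_frame ** \<omega>) ** ?U"
        by (simp add: matrix_transpose_mul frame_grams flip: matrix_mul_assoc)
    qed auto
    have "(\<lambda>g. f (g ** (top_frame ** \<omega>0))) \<in> borel_measurable H"
      using haar_orbit_integrable[OF f stiefel_mult[OF frames_in_stiefel(1) \<omega>0]] by simp
    then have "(\<lambda>g. \<Psi> (g ** ?U) *\<^sub>R f (g ** (top_frame ** \<omega>0))) \<in> borel_measurable H"
      by measurable
    from haar_integral_right[OF this t(1)]
    show "?I = (\<integral>g. \<Psi> (g ** ?U) *\<^sub>R f (embed g \<omega>) \<partial>H)"
      unfolding matrix_mul_assoc[symmetric] t(2,3) embed_def by simp
  qed
  also have "\<dots> = (\<integral>g. (\<integral>\<omega>. \<Psi> (g ** ?U) *\<^sub>R f (embed g \<omega>) \<partial>\<nu>) \<partial>H)"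
    by (rule haar_nu.Fubini_integral[OF int])
  also have "\<dots> = (\<integral>g. \<Psi> (g ** ?U) *\<^sub>R funk \<nu> f (g ** ?U) \<partial>H)"
    by (intro Bochner_Integration.integral_cong refl) (simp add: funk_eq haar_space)
  also have "\<dots> = 0"
  proof (rule integral_eq_zero_AE)
    note orbit = right_haar_orbit[OF sigma haar frames_in_stiefel(2)]
    have "AE u in distr H \<sigma> (\<lambda>g. g ** bottom_frame). funk \<nu> f u = 0"
      using zero unfolding orbit(2) .
    then have "AE g in H. funk \<nu> f (g ** ?U) = 0"
      by (rule AE_distrD[OF orbit(1)])
    then show "AE g in H. \<Psi> (g ** ?U) *\<^sub>R funk \<nu> f (g ** ?U) = 0"
      by eventually_elim simp
  qed
  finally show ?thesis .
qed

text \<open>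
  With \<open>r\<close> such that \<open>bottom_frame ** r\<close> has the same Gram matrix as \<open>y\<close>, a rotation fixes \<open>v0\<close> and
  carries \<open>bottom_frame ** r\<close> to \<open>y\<close>.  Right invariance of \<open>H\<close> removes this rotation and leaves a
  function of the random frame \<open>g ** bottom_frame\<close>, to which \<open>funk_zero_pairing\<close> applies.
\<close>

lemma funk_zero_orthogonal_pairing:
  fixes f :: "real^'m^('l + 'k) \<Rightarrow> complex" and y :: "real^'k^('l + 'k)"
  assumes f: "integrable \<mu> f" and zero: "AE u in \<sigma>. funk \<nu> f u = 0"
    and v0: "v0 = top_frame ** \<omega>0" "\<omega>0 \<in> stiefel" and y: "transpose v0 ** y = 0"
    and h: "continuous_on UNIV h"
  shows "(\<integral>g. h (g ** y) *\<^sub>R f (g ** v0) \<partial>H) = 0"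
proof -
  let ?U = "bottom_frame :: real^'k^('l + 'k)"
  obtain r :: "real^'k^'k" where r: "transpose r ** r = transpose y ** y"
    using gram_factor .
  obtain t where t: "orthogonal_matrix t" "t ** v0 = v0" "t ** (?U ** r) = y"
  proof (rule align_pair[of v0 v0 "?U ** r" y])
    have "transpose v0 ** ?U = 0"
      unfolding v0(1) by (simp add: matrix_transpose_mul frame_grams flip: matrix_mul_assoc)
    then show "transpose v0 ** (?U ** r) = transpose v0 ** y"
      by (simp add: y matrix_mul_assoc)
    show "transpose (?U ** r) ** (?U ** r) = transpose y ** y"
      unfolding r[symmetric] by (simp add: matrix_transpose_mul matrix_mul_assoc)
        (simp add: frame_grams flip: matrix_mul_assoc[of "transpose r"])
  qed auto
  have v0_stiefel: "v0 \<in> stiefel"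
    using v0 by (simp add: stiefel_mult frames_in_stiefel)
  have [measurable]: "h \<in> borel_measurable borel"
    using h by (rule borel_measurable_continuous_onI)
  note [measurable] = measurable_haar_id
  have "compact ((\<lambda>u. h (u ** r)) ` (stiefel :: (real^'k^('l + 'k)) set))"
    by (intro compact_continuous_image compact_stiefel continuous_on_compose2[OF h] continuous_intros) auto
  then obtain C where C: "\<And>u :: real^'k^('l + 'k). u \<in> stiefel \<Longrightarrow> \<bar>h (u ** r)\<bar> \<le> C"
    using compact_imp_bounded by (fastforce simp: bounded_iff)
  have "(\<lambda>g. f (g ** v0)) \<in> borel_measurable H"
    using haar_orbit_integrable[OF f v0_stiefel] by simp
  then have "(\<lambda>g. h (g ** (?U ** r)) *\<^sub>R f (g ** v0)) \<in> borel_measurable H"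
    by measurable
  from haar_integral_right[OF this t(1)]
  have "(\<integral>g. h (g ** y) *\<^sub>R f (g ** v0) \<partial>H) = (\<integral>g. h ((g ** ?U) ** r) *\<^sub>R f (g ** v0) \<partial>H)"
    unfolding matrix_mul_assoc[symmetric] t(2,3) .
  also have "\<dots> = 0"
    unfolding v0(1) by (rule funk_zero_pairing[OF f zero v0(2), of "\<lambda>u. h (u ** r)"]) (use C in auto)
  finally show ?thesis .
qed

text \<open>
  Projecting a uniform random point \<open>y\<close> of the unit ball onto the matrices with columns orthogonal
  to \<open>v0\<close> produces admissible arguments for \<open>funk_zero_orthogonal_pairing\<close>.  In the inner product
  with \<open>b\<close> both the projection and the rotation can be moved over to \<open>b\<close>, and \<open>ball_moment\<close>
  evaluates the integral over \<open>y\<close>.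
\<close>

lemma funk_zero_moments:
  fixes f :: "real^'m^('l + 'k) \<Rightarrow> complex" and b :: "real^'k^('l + 'k)"
  assumes f: "integrable \<mu> f" and zero: "AE u in \<sigma>. funk \<nu> f u = 0"
  shows "(\<integral>v. norm (b - v ** (transpose v ** b)) ^ (2 * d) *\<^sub>R f v \<partial>\<mu>) = 0"
proof -
  obtain \<omega>0 :: "real^'m^'l" where \<omega>0: "\<omega>0 \<in> stiefel"
    using nu.not_empty nu_space by auto
  define v0 :: "real^'m^('l + 'k)" where v0: "v0 = top_frame ** \<omega>0"
  have v0_stiefel: "v0 \<in> stiefel"
    using \<omega>0 by (simp add: v0 stiefel_mult frames_in_stiefel)
  then have gram: "transpose v0 ** v0 = mat 1"
    by (simp add: stiefel_def)
  define P where "P = mat 1 - v0 ** transpose v0"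
  have P: "transpose v0 ** P = 0" "transpose P = P"
    by (simp_all add: P_def matrix_diff_ldistrib matrix_mul_assoc gram transpose_diff matrix_transpose_mul)
  have normP: "norm (P ** y) \<le> norm y" for y :: "real^'k^('l + 'k)"
    using norm_orthogonal_component[OF v0_stiefel, of y]
    by (simp add: P_def matrix_diff_rdistrib matrix_mul_assoc)
  define B where "B = restrict_space lborel (ball (0 :: real^'k^('l + 'k)) 1)"
  have B_space: "space B = ball 0 1"
    by (simp add: B_def space_restrict_space)
  have B_finite: "finite_measure B"
    unfolding B_def using emeasure_lborel_ball_finite[of "0 :: real^'k^('l + 'k)" 1]
    by (intro finite_measureI) (simp add: space_restrict_space emeasure_restrict_space)
  have B_id: "(\<lambda>y. y) \<in> borel_measurable B"
    unfolding B_def by (intro measurable_restrict_space1) simp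
  obtain c where c: "c \<noteq> 0"
    "\<And>a :: real^'k^('l + 'k). (\<integral>y. (y \<bullet> a) ^ (2 * d) \<partial>B) = c * norm a ^ (2 * d)"
    using ball_moment[of d] unfolding B_def by blast
  define K where "K g y = ((g ** (P ** y)) \<bullet> b) ^ (2 * d)" for g :: "real^('l + 'k)^('l + 'k)" and y
  have K_meas: "(\<lambda>(g, y). K g y) \<in> borel_measurable (H \<Otimes>\<^sub>M B)"
    unfolding K_def split_beta'
    by (intro borel_measurable_power borel_measurable_inner borel_measurable_matrix_mult borel_measurable_const
        measurable_compose[OF measurable_fst measurable_haar_id] measurable_compose[OF measurable_snd B_id])
  have K_bound: "\<bar>K g y\<bar> \<le> norm b ^ (2 * d)" if "g \<in> space H" "y \<in> space B" for g y
  proof -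
    have "\<bar>(g ** (P ** y)) \<bullet> b\<bar> \<le> norm (P ** y) * norm b"
      using Cauchy_Schwarz_ineq2[of "g ** (P ** y)" b] that(1)
      by (simp add: norm_orthogonal_mult haar_space)
    also have "\<dots> \<le> 1 * norm b"
      using normP[of y] that(2) by (intro mult_right_mono) (auto simp: B_space)
    finally show ?thesis
      unfolding K_def power_abs by (intro power_mono) auto
  qed
  have K_moment: "(\<integral>y. K g y \<partial>B) = c * norm (b - (g ** v0) ** (transpose (g ** v0) ** b)) ^ (2 * d)"
    if "orthogonal_matrix g" for g
  proof -
    have "K g y = (y \<bullet> (P ** (transpose g ** b))) ^ (2 * d)" for y
      by (simp add: K_def inner_matrix_mult_left P)
    then have "(\<integral>y. K g y \<partial>B) = c * norm (P ** (transpose g ** b)) ^ (2 * d)"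
      by (simp add: c(2))
    also have "norm (P ** (transpose g ** b)) = norm (g ** (P ** (transpose g ** b)))"
      by (simp add: norm_orthogonal_mult[OF that])
    also have "g ** (P ** (transpose g ** b)) = b - (g ** v0) ** (transpose (g ** v0) ** b)"
      by (simp add: P_def matrix_diff_rdistrib matrix_diff_ldistrib orthogonal_matrixD(4)[OF that] matrix_transpose_mul
          flip: matrix_mul_assoc)
    finally show ?thesis .
  qed
  have fH: "integrable H (\<lambda>g. f (g ** v0))"
    by (rule haar_orbit_integrable[OF f v0_stiefel])
  have "0 = (\<integral>y. (\<integral>g. K g y *\<^sub>R f (g ** v0) \<partial>H) \<partial>B)"
  proof -
    have "(\<integral>g. K g y *\<^sub>R f (g ** v0) \<partial>H) = 0" for y
      unfolding K_def
      by (rule funk_zero_orthogonal_pairing[OF f zero v0 \<omega>0, where h = "\<lambda>x. (x \<bullet> b) ^ (2 * d)"])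
        (auto simp: matrix_mul_assoc P intro!: continuous_intros)
    then show ?thesis
      by simp
  qed
  also have "\<dots> = (\<integral>g. (\<integral>y. K g y \<partial>B) *\<^sub>R f (g ** v0) \<partial>H)"
    by (rule integral_bounded_kernel_swap[OF _ B_finite fH K_meas K_bound]) (auto intro: haar.finite_measure)
  also have "\<dots> = (\<integral>g. c *\<^sub>R (norm (b - (g ** v0) ** (transpose (g ** v0) ** b)) ^ (2 * d) *\<^sub>R f (g ** v0)) \<partial>H)"
    by (intro Bochner_Integration.integral_cong refl) (simp add: K_moment haar_space)
  also have "\<dots> = c *\<^sub>R (\<integral>g. norm (b - (g ** v0) ** (transpose (g ** v0) ** b)) ^ (2 * d) *\<^sub>R f (g ** v0) \<partial>H)"
    by (rule Bochner_Integration.integral_scaleR_right)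
  also have "(\<integral>g. norm (b - (g ** v0) ** (transpose (g ** v0) ** b)) ^ (2 * d) *\<^sub>R f (g ** v0) \<partial>H)
    = (\<integral>v. norm (b - v ** (transpose v ** b)) ^ (2 * d) *\<^sub>R f v \<partial>\<mu>)"
  proof (rule haar_orbit_integral[OF _ v0_stiefel])
    note [measurable] = borel_measurable_integrable[OF f] measurable_restricted_id[OF mu_sets]
    show "(\<lambda>v. norm (b - v ** (transpose v ** b)) ^ (2 * d) *\<^sub>R f v) \<in> borel_measurable \<mu>"
      by measurable
  qed
  finally show ?thesis
    using c(1) by simp
qed

end

text \<open>
  Indicators of closed sets are limits of the continuous functions \<open>max 0 (1 - n * infdist x C)\<close>, and
  closed sets generate the Borel sets; so all set integrals of \<open>\<phi>\<close> vanish.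
\<close>

lemma AE_zero_if_orthogonal_to_continuous:
  fixes \<phi> :: "'a::euclidean_space \<Rightarrow> 'c::{banach, second_countable_topology}"
  assumes M: "finite_measure M" and sets: "sets M = sets (restrict_space borel S)"
    and \<phi>: "integrable M \<phi>"
    and zero: "\<And>g :: 'a \<Rightarrow> real. continuous_on UNIV g \<Longrightarrow> (\<And>x. \<bar>g x\<bar> \<le> 1) \<Longrightarrow> (\<integral>x. g x *\<^sub>R \<phi> x \<partial>M) = 0"
  shows "AE x in M. \<phi> x = 0"
proof -
  interpret M: finite_measure M by (rule M)
  have space: "space M = S"
    using sets_eq_imp_space_eq[OF sets] by (simp add: space_restrict_space)
  have id: "(\<lambda>x. x) \<in> borel_measurable M"
    by (subst measurable_cong_sets[OF sets refl]) (simp add: measurable_restrict_space1)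
  have ind[measurable]: "(\<lambda>x. indicator B x :: real) \<in> borel_measurable M" if "B \<in> sets borel" for B
    using measurable_compose[OF id borel_measurable_indicator[OF that]] by simp
  have int_ind: "integrable M (\<lambda>x. indicator B x *\<^sub>R \<phi> x)" if "B \<in> sets borel" for B
    by (rule integrable_bounded_scaleR[OF \<phi> ind[OF that], where C = 1]) (simp add: indicator_def)
  note [measurable] = borel_measurable_integrable[OF \<phi>]
  have closed: "(\<integral>x. indicator C x *\<^sub>R \<phi> x \<partial>M) = 0" if C: "closed C" for C
  proof (cases "C = {}")
    case False
    define g where "g n x = max 0 (1 - real n * infdist x C)" for n x
    have cont: "continuous_on UNIV (g n)" for n
      unfolding g_def by (intro continuous_intros)
    have bound: "\<bar>g n x\<bar> \<le> 1" for n x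
      by (simp add: g_def infdist_nonneg)
    have lim: "(\<lambda>n. g n x) \<longlonglongrightarrow> indicator C x" for x
    proof (cases "x \<in> C")
      case True
      then show ?thesis
        by (simp add: g_def)
    next
      case x: False
      then have pos: "infdist x C > 0"
        using C False in_closed_iff_infdist_zero infdist_nonneg by (metis less_eq_real_def)
      obtain N where "1 / infdist x C < real N"
        using reals_Archimedean2 by blast
      then have "1 < real N * infdist x C"
        using pos by (simp add: divide_less_eq)
      moreover have "real N * infdist x C \<le> real n * infdist x C" if "n \<ge> N" for n
        using that pos by (intro mult_right_mono) auto
      ultimately have "g n x = 0" if "n \<ge> N" for n
        using that by (fastforce simp: g_def)
      then have "\<forall>\<^sub>F n in sequentially. g n x = indicator C x"
        using x by (auto simp: eventually_sequentially)
      then show ?thesis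
        by (rule tendsto_eventually)
    qed
    have "(\<lambda>n. \<integral>x. g n x *\<^sub>R \<phi> x \<partial>M) \<longlonglongrightarrow> (\<integral>x. indicator C x *\<^sub>R \<phi> x \<partial>M)"
    proof (rule integral_dominated_convergence[where w = "\<lambda>x. norm (\<phi> x)"])
      show "(\<lambda>x. indicator C x *\<^sub>R \<phi> x) \<in> borel_measurable M"
        using int_ind[of C] C by auto
      show "(\<lambda>x. g n x *\<^sub>R \<phi> x) \<in> borel_measurable M" for n
        using measurable_compose[OF id borel_measurable_continuous_onI[OF cont[of n]]] by measurable
      show "integrable M (\<lambda>x. norm (\<phi> x))"
        using \<phi> by simp
      show "AE x in M. (\<lambda>n. g n x *\<^sub>R \<phi> x) \<longlonglongrightarrow> indicator C x *\<^sub>R \<phi> x"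
        by (intro AE_I2 tendsto_scaleR lim tendsto_const)
      show "AE x in M. norm (g n x *\<^sub>R \<phi> x) \<le> norm (\<phi> x)" for n
        using bound by (intro AE_I2) (simp add: mult_left_le_one_le)
    qed
    moreover have "(\<integral>x. g n x *\<^sub>R \<phi> x \<partial>M) = 0" for n
      by (rule zero[OF cont bound])
    ultimately show ?thesis
      by (simp add: LIMSEQ_const_iff)
  qed simp
  have borel: "(\<integral>x. indicator B x *\<^sub>R \<phi> x \<partial>M) = 0" if "B \<in> sets borel" for B
  proof -
    have "Int_stable {C :: 'a set. closed C}"
      by (auto simp: Int_stable_def)
    moreover have "{C :: 'a set. closed C} \<subseteq> Pow UNIV"
      by simp
    moreover have "B \<in> sigma_sets UNIV {C :: 'a set. closed C}"
      using that by (simp add: borel_eq_closed)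
    ultimately show ?thesis
    proof (induction rule: sigma_sets_induct_disjoint)
      case (basic C)
      then show ?case
        using closed by simp
    next
      case empty
      then show ?case
        by simp
    next
      case (compl C)
      then have C: "C \<in> sets borel"
        by (simp add: borel_eq_closed)
      have "indicator (UNIV - C) x *\<^sub>R \<phi> x = indicator UNIV x *\<^sub>R \<phi> x - indicator C x *\<^sub>R \<phi> x" for x
        by (simp add: indicator_def)
      then show ?case
        using compl.IH closed[of UNIV] C by (simp add: int_ind \<phi>)
    next
      case (union A)
      have A: "A i \<in> sets borel" for i
        using union by (auto simp: borel_eq_closed)
      have "(\<lambda>n. \<integral>x. (\<Sum>i<n. indicator (A i) x) *\<^sub>R \<phi> x \<partial>M) \<longlonglongrightarrow> (\<integral>x. indicator (\<Union>i. A i) x *\<^sub>R \<phi> x \<partial>M)"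
      proof (rule integral_dominated_convergence[where w = "\<lambda>x. norm (\<phi> x)"])
        show "(\<lambda>x. indicator (\<Union>i. A i) x *\<^sub>R \<phi> x) \<in> borel_measurable M"
          using A by (intro borel_measurable_integrable int_ind) auto
        show "(\<lambda>x. (\<Sum>i<n. indicator (A i) x) *\<^sub>R \<phi> x) \<in> borel_measurable M" for n
          using A by (intro borel_measurable_scaleR borel_measurable_sum ind) auto
        show "integrable M (\<lambda>x. norm (\<phi> x))"
          using \<phi> by simp
        have sum: "(\<Sum>i<n. indicator (A i) x) = (indicator (\<Union>i<n. A i) x :: real)" for n x
          using union(1) by (subst indicator_UN_disjoint) (auto simp: disjoint_family_on_def)
        show "AE x in M. (\<lambda>n. (\<Sum>i<n. indicator (A i) x) *\<^sub>R \<phi> x) \<longlonglongrightarrow> indicator (\<Union>i. A i) x *\<^sub>R \<phi> x"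
          unfolding sum by (intro AE_I2 tendsto_scaleR LIMSEQ_indicator_UN tendsto_const)
        show "AE x in M. norm ((\<Sum>i<n. indicator (A i) x) *\<^sub>R \<phi> x) \<le> norm (\<phi> x)" for n
          unfolding sum by (intro AE_I2) (simp add: indicator_def)
      qed
      moreover have "(\<integral>x. (\<Sum>i<n. indicator (A i) x) *\<^sub>R \<phi> x \<partial>M) = 0" for n
      proof -
        have "(\<integral>x. (\<Sum>i<n. indicator (A i) x) *\<^sub>R \<phi> x \<partial>M) = (\<Sum>i<n. \<integral>x. indicator (A i) x *\<^sub>R \<phi> x \<partial>M)"
          unfolding scaleR_sum_left by (rule Bochner_Integration.integral_sum) (rule int_ind[OF A])
        then show ?thesis
          by (simp only: union.IH sum.neutral_const)
      qed
      ultimately show ?case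
        by (simp add: LIMSEQ_const_iff)
    qed
  qed
  show ?thesis
  proof (rule M.density_zero[OF \<phi>])
    fix A assume "A \<in> sets M"
    then obtain B where B: "B \<in> sets borel" "A = S \<inter> B"
      by (auto simp: sets sets_restrict_space)
    have "set_lebesgue_integral M A \<phi> = (\<integral>x. indicator B x *\<^sub>R \<phi> x \<partial>M)"
      unfolding set_lebesgue_integral_def
      by (rule Bochner_Integration.integral_cong) (auto simp: B(2) space indicator_def)
    then show "set_lebesgue_integral M A \<phi> = 0"
      using borel[OF B(1)] by simp
  qed
qed

lemma zero_of_small_multiples:
  fixes x :: "'a::real_normed_vector"
  assumes "\<And>e. e > 0 \<Longrightarrow> norm x \<le> e * C"
  shows "x = 0"
proof (rule ccontr)
  assume "x \<noteq> 0"
  then have pos: "norm x > 0"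
    by simp
  have "norm x \<le> norm x / (2 * (\<bar>C\<bar> + 1)) * C"
    using pos by (intro assms) simp
  also have "\<dots> \<le> norm x / (2 * (\<bar>C\<bar> + 1)) * (\<bar>C\<bar> + 1)"
    using pos by (intro mult_left_mono) auto
  also have "\<dots> = norm x / 2"
    by (simp add: field_simps add_nonneg_eq_0_iff)
  finally show False
    using pos by simp
qed

section \<open>Approximate identities on the Stiefel manifold\<close>

text \<open>
  For frames \<open>v\<close> and \<open>c\<close> this is half the squared Hilbert--Schmidt distance between the orthogonal
  projections onto their column spaces.
\<close>

definition deviation :: "real^'m^'n \<Rightarrow> real^'m^'n \<Rightarrow> real" where
  "deviation v c = (norm (c - v ** (transpose v ** c)))\<^sup>2"

lemma deviation_nonneg: "deviation v c \<ge> 0"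
  by (simp add: deviation_def)

lemma continuous_on_deviation [continuous_intros]:
  fixes f g :: "'x::topological_space \<Rightarrow> real^'m^'n"
  assumes "continuous_on S f" "continuous_on S g"
  shows "continuous_on S (\<lambda>x. deviation (f x) (g x))"
  unfolding deviation_def by (intro continuous_intros assms)

lemma borel_measurable_deviation [measurable (raw)]:
  fixes f g :: "'x \<Rightarrow> real^'m^'n"
  assumes "f \<in> borel_measurable M" "g \<in> borel_measurable M"
  shows "(\<lambda>x. deviation (f x) (g x)) \<in> borel_measurable M"
  unfolding deviation_def using assms by measurable

lemma deviation_orthogonal:
  fixes v c :: "real^'m^'n"
  assumes "orthogonal_matrix g"
  shows "deviation (g ** v) (g ** c) = deviation v c"
proof -
  have "g ** c - g ** v ** (transpose (g ** v) ** (g ** c)) = g ** (c - v ** (transpose v ** c))"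
    by (simp only: gram_orthogonal_mult[OF assms] matrix_diff_ldistrib flip: matrix_mul_assoc)
  then show ?thesis
    by (simp add: deviation_def norm_orthogonal_mult[OF assms])
qed

lemma deviation_self: "v \<in> stiefel \<Longrightarrow> deviation v v = 0"
  by (simp add: deviation_def stiefel_def)

lemma deviation_zeroD:
  assumes "v \<in> stiefel" "c \<in> stiefel" "deviation v c = 0"
  obtains \<gamma> where "orthogonal_matrix \<gamma>" "c = v ** \<gamma>"
proof
  show c: "c = v ** (transpose v ** c)"
    using assms(3) by (simp add: deviation_def)
  have "transpose (transpose v ** c) ** (transpose v ** c) = transpose c ** (v ** (transpose v ** c))"
    by (simp add: matrix_transpose_mul matrix_mul_assoc)
  also have "\<dots> = mat 1"
    using assms(2) by (simp add: stiefel_def flip: c)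
  finally show "orthogonal_matrix (transpose v ** c)"
    by (simp add: orthogonal_matrix)
qed

text \<open>
  On the compact set of pairs with \<open>e \<le> \<bar>g c - g v\<bar>\<close> the deviation attains its minimum, and a minimum
  \<open>0\<close> would give two frames of the same column space at which \<open>g\<close> differs.
\<close>

lemma right_invariant_modulus:
  fixes g :: "real^'m^'n \<Rightarrow> real"
  assumes cont: "continuous_on UNIV g"
    and inv: "\<And>v \<gamma>. orthogonal_matrix \<gamma> \<Longrightarrow> g (v ** \<gamma>) = g v" and e: "e > 0"
  obtains \<delta> where "\<delta> > 0" "\<And>v c. v \<in> stiefel \<Longrightarrow> c \<in> stiefel \<Longrightarrow> deviation v c < \<delta> \<Longrightarrow> \<bar>g c - g v\<bar> < e"
proof -
  define K where "K = (stiefel \<times> stiefel) \<inter> {p. e \<le> \<bar>g (snd p) - g (fst p)\<bar>}"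
  have "compact K"
    unfolding K_def
    by (intro compact_Int_closed compact_Times compact_stiefel closed_Collect_le continuous_intros
        continuous_on_compose2[OF cont]) auto
  show ?thesis
  proof (cases "K = {}")
    case True
    show ?thesis
      by (rule that[of 1]) (use True in \<open>auto simp: K_def not_le\<close>)
  next
    case False
    have "continuous_on K (\<lambda>p. deviation (fst p) (snd p))"
      by (intro continuous_intros)
    then obtain p where p: "p \<in> K" "\<And>q. q \<in> K \<Longrightarrow> deviation (fst p) (snd p) \<le> deviation (fst q) (snd q)"
      using continuous_attains_inf[OF \<open>compact K\<close> False] by blast
    have "deviation (fst p) (snd p) \<noteq> 0"
    proof
      assume "deviation (fst p) (snd p) = 0"
      moreover have "fst p \<in> stiefel" "snd p \<in> stiefel"
        using p(1) by (auto simp: K_def)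
      ultimately obtain \<gamma> where "orthogonal_matrix \<gamma>" "snd p = fst p ** \<gamma>"
        using deviation_zeroD by blast
      then show False
        using p(1) e inv by (auto simp: K_def)
    qed
    then have "deviation (fst p) (snd p) > 0"
      using deviation_nonneg[of "fst p" "snd p"] by simp
    then show ?thesis
    proof (rule that)
      fix v c :: "real^'m^'n"
      assume "v \<in> stiefel" "c \<in> stiefel" "deviation v c < deviation (fst p) (snd p)"
      then show "\<bar>g c - g v\<bar> < e"
        using p(2)[of "(v, c)"] by (force simp: K_def)
    qed
  qed
qed

text \<open>
  The integral does not depend on \<open>v\<close>, by transitivity.  If it were zero, every neighbourhood
  \<open>{c. deviation v c < \<delta>}\<close> would be a null set, and finitely many of them cover the compact
  Stiefel manifold.
\<close>

lemma bump_integral_positive: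
  fixes M :: "(real^'m^'n) measure"
  assumes M: "invariant_prob stiefel M" and \<delta>: "\<delta> > 0"
  obtains Z where "Z > 0" "\<And>v. v \<in> stiefel \<Longrightarrow> (\<integral>c. max 0 (\<delta> - deviation v c) \<partial>M) = Z"
proof -
  note M' = invariant_probD[OF M]
  interpret M: prob_space M by (rule M'(1))
  note [measurable] = measurable_restricted_id[OF M'(2)]
  let ?Z = "\<lambda>v. \<integral>c. max 0 (\<delta> - deviation v c) \<partial>M"
  have meas[measurable]: "(\<lambda>c. max 0 (\<delta> - deviation v c)) \<in> borel_measurable M" for v
    by measurable
  obtain v0 where v0: "v0 \<in> space M"
    using M.not_empty by blast
  have Z: "?Z v = ?Z v0" if v: "v \<in> stiefel" for v
  proof -
    define h where "h = align v0 v"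
    have h: "orthogonal_matrix h" "h ** v0 = v"
      using v v0 by (auto simp: h_def orthogonal_matrix_align stiefel_def M'(3) intro!: align_mult)
    have "?Z v = (\<integral>c. max 0 (\<delta> - deviation v c) \<partial>distr M M (\<lambda>c. h ** c))"
      by (simp add: M'(4)[OF h(1)])
    also have "\<dots> = (\<integral>c. max 0 (\<delta> - deviation v (h ** c)) \<partial>M)"
      by (rule integral_distr[OF measurable_mult_left[OF M'(2) h(1)] meas])
    also have "\<dots> = ?Z v0"
      by (simp add: deviation_orthogonal[OF h(1)] flip: h(2))
    finally show ?thesis .
  qed
  have integrable: "integrable M (\<lambda>c. max 0 (\<delta> - deviation v c))" for v
    by (rule M.integrable_const_bound[where B = \<delta>])
      (use \<delta> deviation_nonneg in \<open>auto simp: meas\<close>)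
  have "?Z v0 \<noteq> 0"
  proof
    assume "?Z v0 = 0"
    then have AE: "AE c in M. \<not> deviation v c < \<delta>" if "v \<in> stiefel" for v
    proof -
      have "AE c in M. max 0 (\<delta> - deviation v c) = 0"
        using integral_nonneg_eq_0_iff_AE[OF integrable[of v]] Z[OF that] \<open>?Z v0 = 0\<close> by simp
      then show ?thesis
        by eventually_elim auto
    qed
    have "open {c :: real^'m^'n. deviation v c < \<delta>}" for v
      by (intro open_Collect_less continuous_intros)
    moreover have "stiefel \<subseteq> (\<Union>v\<in>stiefel. {c :: real^'m^'n. deviation v c < \<delta>})"
      using deviation_self \<delta> by force
    ultimately obtain F where F: "F \<subseteq> stiefel" "finite F"
      "stiefel \<subseteq> (\<Union>v\<in>F. {c :: real^'m^'n. deviation v c < \<delta>})"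
      using compactE_image[OF compact_stiefel] by metis
    have "AE c in M. \<forall>v\<in>F. \<not> deviation v c < \<delta>"
      using F AE by (intro AE_finite_allI) auto
    then have "AE c in M. c \<notin> space M"
      by eventually_elim (use F(3) M'(3) in blast)
    then have "AE c in M. False"
      using AE_space by eventually_elim simp
    then show False
      by simp
  qed
  moreover have "?Z v0 \<ge> 0"
    by (rule Bochner_Integration.integral_nonneg) simp
  ultimately have "?Z v0 > 0"
    by (metis less_eq_real_def)
  then show ?thesis
    using Z by (rule that)
qed

context funk_setting
begin

text \<open>
  Padding \<open>c\<close> with zero columns to an \<open>n \<times> k\<close> matrix turns the moments of \<open>funk_zero_moments\<close> into
  powers of the deviation; this is where \<open>m \<le> k\<close> enters.  Weierstrass approximation passes from
  polynomials to continuous functions.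
\<close>

lemma funk_zero_deviation_kernel:
  fixes f :: "real^'m^('l + 'k) \<Rightarrow> complex" and p :: "real \<Rightarrow> real"
  assumes f: "integrable \<mu> f" and zero: "AE u in \<sigma>. funk \<nu> f u = 0"
    and card: "CARD('m) \<le> CARD('k)" and c: "c \<in> stiefel" and p: "continuous_on UNIV p"
  shows "(\<integral>v. p (deviation v c) *\<^sub>R f v \<partial>\<mu>) = 0"
proof -
  obtain \<iota> :: "'m \<Rightarrow> 'k" where "inj \<iota>"
    using card_le_inj[of "UNIV :: 'm set" "UNIV :: 'k set"] card by auto
  \<comment> \<open>Right multiplication by \<open>J\<close> places the \<open>m\<close> columns among \<open>k\<close> and fills up with zeros.\<close>
  define J :: "real^'k^'m" where "J = (\<chi> i j. if \<iota> i = j then 1 else 0)"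
  have "(J ** transpose J) $ i $ i' = mat 1 $ i $ i'" for i i'
  proof -
    have "(J ** transpose J) $ i $ i' = (\<Sum>j\<in>UNIV. if \<iota> i = j then (if i = i' then 1 else 0) else 0)"
      unfolding J_def matrix_matrix_mult_def transpose_def vec_lambda_beta
      by (intro sum.cong refl) (use \<open>inj \<iota>\<close> in \<open>auto simp: inj_eq\<close>)
    then show ?thesis
      by (simp add: mat_def)
  qed
  then have "J ** transpose J = mat 1"
    by (simp add: vec_eq_iff)
  then have norm_J: "norm (x ** J) = norm x" for x :: "real^'m^('l + 'k)"
    by (simp add: norm_eq_sqrt_inner inner_matrix_mult_right flip: matrix_mul_assoc)
  note [measurable] = borel_measurable_integrable[OF f] measurable_restricted_id[OF mu_sets]
    borel_measurable_continuous_onI[OF p]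
  have moment: "(\<integral>v. deviation v c ^ d *\<^sub>R f v \<partial>\<mu>) = 0" for d
  proof -
    have "norm (c ** J - v ** (transpose v ** (c ** J))) ^ (2 * d) = deviation v c ^ d" for v
    proof -
      have "c ** J - v ** (transpose v ** (c ** J)) = (c - v ** (transpose v ** c)) ** J"
        by (simp add: matrix_diff_rdistrib matrix_mul_assoc)
      then show ?thesis
        by (simp add: norm_J deviation_def power_mult)
    qed
    then show ?thesis
      using funk_zero_moments[OF f zero, of "c ** J" d] by simp
  qed
  define L where "L = (norm c)\<^sup>2"
  have range: "deviation v c \<in> {0..L}" if "v \<in> space \<mu>" for v
    using norm_orthogonal_component[of v c] that
    by (simp add: deviation_def L_def mu_space power_mono)
  have compact_bound: "\<exists>C. \<forall>v\<in>space \<mu>. \<bar>q (deviation v c)\<bar> \<le> C" if "continuous_on {0..L} q" for q :: "real \<Rightarrow> real"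
  proof -
    have "bounded (q ` {0..L})"
      using compact_imp_bounded[OF compact_continuous_image[OF that]] by simp
    then show ?thesis
      using range unfolding bounded_iff by force
  qed
  have integrable: "integrable \<mu> (\<lambda>v. q (deviation v c) *\<^sub>R f v)" if q: "continuous_on UNIV q" for q :: "real \<Rightarrow> real"
  proof -
    obtain C where "\<And>v. v \<in> space \<mu> \<Longrightarrow> \<bar>q (deviation v c)\<bar> \<le> C"
      using compact_bound[OF continuous_on_subset[OF q]] by blast
    moreover have "(\<lambda>v. q (deviation v c)) \<in> borel_measurable \<mu>"
      by (rule measurable_compose[OF _ borel_measurable_continuous_onI[OF q]]) measurable
    ultimately show ?thesis
      using integrable_bounded_scaleR[OF f] by blast
  qed
  have "norm (\<integral>v. p (deviation v c) *\<^sub>R f v \<partial>\<mu>) \<le> e * (\<integral>v. norm (f v) \<partial>\<mu>)" if e: "e > 0" for e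
  proof -
    obtain q where q: "real_polynomial_function q" "\<And>x. x \<in> {0..L} \<Longrightarrow> \<bar>p x - q x\<bar> < e"
      using Stone_Weierstrass_real_polynomial_function[of "{0..L}" p e] p e continuous_on_subset by blast
    obtain a n where q_sum: "q = (\<lambda>x. \<Sum>i\<le>n. a i * x ^ i)"
      using q(1) real_polynomial_function_iff_sum by blast
    have q_cont: "continuous_on UNIV q"
      unfolding q_sum by (intro continuous_intros)
    have "(\<integral>v. q (deviation v c) *\<^sub>R f v \<partial>\<mu>) = (\<integral>v. (\<Sum>i\<le>n. a i *\<^sub>R (deviation v c ^ i *\<^sub>R f v)) \<partial>\<mu>)"
      by (simp add: q_sum scaleR_sum_left)
    also have "\<dots> = (\<Sum>i\<le>n. a i *\<^sub>R (\<integral>v. deviation v c ^ i *\<^sub>R f v \<partial>\<mu>))"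
      unfolding Bochner_Integration.integral_scaleR_right[symmetric]
      by (intro Bochner_Integration.integral_sum integrable_scaleR_right integrable continuous_intros)
    also have "\<dots> = 0"
      by (simp add: moment)
    finally have "(\<integral>v. p (deviation v c) *\<^sub>R f v \<partial>\<mu>) = (\<integral>v. (p (deviation v c) - q (deviation v c)) *\<^sub>R f v \<partial>\<mu>)"
      using integrable[OF p] integrable[OF q_cont] by (simp add: scaleR_diff_left)
    also have "norm \<dots> \<le> e * (\<integral>v. norm (f v) \<partial>\<mu>)"
    proof (rule norm_integral_bounded_scaleR[OF f])
      note [measurable] = borel_measurable_continuous_onI[OF q_cont]
      show "(\<lambda>v. p (deviation v c) - q (deviation v c)) \<in> borel_measurable \<mu>"
        by measurable
      show "\<bar>p (deviation v c) - q (deviation v c)\<bar> \<le> e" if "v \<in> space \<mu>" for v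
        using q(2)[OF range[OF that]] by simp
    qed
    finally show ?thesis .
  qed
  then show ?thesis
    by (rule zero_of_small_multiples)
qed

text \<open>
  The bumps \<open>max 0 (\<delta> - deviation v c)\<close> have the same mass \<open>Z\<close> for all \<open>v\<close>, and \<open>g\<close> is nearly
  constant on the support of each.  So the mean of \<open>g c\<close> against the bump at \<open>v\<close> approximates
  \<open>g v\<close> uniformly, while \<open>f\<close> is orthogonal to all these means.
\<close>

lemma funk_zero_right_invariant_test:
  fixes f :: "real^'m^('l + 'k) \<Rightarrow> complex" and g :: "real^'m^('l + 'k) \<Rightarrow> real"
  assumes f: "integrable \<mu> f" and zero: "AE u in \<sigma>. funk \<nu> f u = 0"
    and card: "CARD('m) \<le> CARD('k)"
    and g: "continuous_on UNIV g" and bound: "\<And>v. \<bar>g v\<bar> \<le> 1"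
    and inv: "\<And>v \<gamma>. orthogonal_matrix \<gamma> \<Longrightarrow> g (v ** \<gamma>) = g v"
  shows "(\<integral>v. g v *\<^sub>R f v \<partial>\<mu>) = 0"
proof (rule zero_of_small_multiples)
  fix e :: real assume e: "e > 0"
  obtain \<delta> where \<delta>: "\<delta> > 0"
    "\<And>v c. v \<in> stiefel \<Longrightarrow> c \<in> stiefel \<Longrightarrow> deviation v c < \<delta> \<Longrightarrow> \<bar>g c - g v\<bar> < e"
    using right_invariant_modulus[OF g inv e] by blast
  define p where "p v c = max 0 (\<delta> - deviation v c)" for v c :: "real^'m^('l + 'k)"
  obtain Z where Z: "Z > 0" "\<And>v. v \<in> stiefel \<Longrightarrow> (\<integral>c. p v c \<partial>\<mu>) = Z"
    using bump_integral_positive[OF mu \<delta>(1)] unfolding p_def by blast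
  have p_bound: "0 \<le> p v c" "p v c \<le> \<delta>" for v c
    using deviation_nonneg[of v c] \<delta>(1) by (auto simp: p_def)
  note mu_id = measurable_restricted_id[OF mu_sets]
  note [measurable] = mu_id borel_measurable_continuous_onI[OF g]
  have fst_snd[measurable]: "fst \<in> borel_measurable (\<mu> \<Otimes>\<^sub>M \<mu>)" "snd \<in> borel_measurable (\<mu> \<Otimes>\<^sub>M \<mu>)"
    using measurable_compose[OF measurable_fst mu_id] measurable_compose[OF measurable_snd mu_id] by auto
  have p_meas[measurable]: "p v \<in> borel_measurable \<mu>" for v
    unfolding p_def by measurable
  have K_meas: "(\<lambda>(v, c). g c * p v c) \<in> borel_measurable (\<mu> \<Otimes>\<^sub>M \<mu>)"
    unfolding p_def split_beta' by measurable
  have K_bound: "\<bar>g c * p v c\<bar> \<le> \<delta>" for v c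
    using mult_mono[OF bound[of c] p_bound(2)[of v c]] p_bound(1)[of v c] by (simp add: abs_mult)
  have int_p: "integrable \<mu> (p v)" and int_gp: "integrable \<mu> (\<lambda>c. g c * p v c)" for v
    using p_bound K_bound by (auto intro!: mu.integrable_const_bound[where B = \<delta>])
  define A where "A v = (\<integral>c. g c * p v c \<partial>\<mu>)" for v
  have A_meas: "A \<in> borel_measurable \<mu>"
    unfolding A_def by (rule mu.borel_measurable_lebesgue_integral[OF K_meas])
  have A_close: "\<bar>Z * g v - A v\<bar> \<le> e * Z" if v: "v \<in> space \<mu>" for v
  proof -
    have v': "v \<in> stiefel"
      using v by (simp add: mu_space)
    have "Z * g v - A v = (\<integral>c. (g v - g c) * p v c \<partial>\<mu>)"
      using int_p int_gp by (simp add: A_def left_diff_distrib flip: Z(2)[OF v'])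
    also have "\<bar>\<dots>\<bar> \<le> (\<integral>c. e * p v c \<partial>\<mu>)"
    proof (rule integral_abs_bound_integral)
      show "integrable \<mu> (\<lambda>c. (g v - g c) * p v c)"
        using int_p int_gp by (simp add: left_diff_distrib)
      show "integrable \<mu> (\<lambda>c. e * p v c)"
        using int_p by simp
      show "\<bar>(g v - g c) * p v c\<bar> \<le> e * p v c" if "c \<in> space \<mu>" for c
      proof (cases "deviation v c < \<delta>")
        case True
        then have "\<bar>g v - g c\<bar> \<le> e"
          using \<delta>(2)[OF v', of c] that by (simp add: mu_space abs_minus_commute)
        then show ?thesis
          using p_bound(1)[of v c] by (simp add: abs_mult mult_right_mono)
      qed (simp add: p_def)
    qed
    also have "\<dots> = e * Z"
      by (simp add: Z(2)[OF v'])
    finally show ?thesis .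
  qed
  have "0 = (\<integral>c. g c *\<^sub>R (\<integral>v. p v c *\<^sub>R f v \<partial>\<mu>) \<partial>\<mu>)"
  proof -
    have "(\<integral>v. p v c *\<^sub>R f v \<partial>\<mu>) = 0" if "c \<in> space \<mu>" for c
      unfolding p_def using that
      by (intro funk_zero_deviation_kernel[OF f zero card, where p = "\<lambda>s. max 0 (\<delta> - s)"] continuous_intros)
        (simp add: mu_space)
    then show ?thesis
      by (simp cong: Bochner_Integration.integral_cong)
  qed
  also have "\<dots> = (\<integral>c. (\<integral>v. (g c * p v c) *\<^sub>R f v \<partial>\<mu>) \<partial>\<mu>)"
    by (simp flip: scaleR_scaleR)
  also have "\<dots> = (\<integral>v. A v *\<^sub>R f v \<partial>\<mu>)"
    unfolding A_def
    by (rule integral_bounded_kernel_swap[OF mu.finite_measure_axioms mu.finite_measure_axioms f K_meas K_bound])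
  finally have A_zero: "(\<integral>v. A v *\<^sub>R f v \<partial>\<mu>) = 0" ..
  have int_gf: "integrable \<mu> (\<lambda>v. g v *\<^sub>R f v)"
    by (rule integrable_bounded_scaleR[OF f _ bound]) measurable
  have A_bound: "\<bar>A v\<bar> \<le> e * Z + Z" if "v \<in> space \<mu>" for v
  proof -
    have "\<bar>Z * g v\<bar> \<le> Z"
      using Z(1) bound[of v] by (simp add: abs_mult mult_left_le)
    then show ?thesis
      using A_close[OF that] by linarith
  qed
  have int_Af: "integrable \<mu> (\<lambda>v. A v *\<^sub>R f v)"
    by (rule integrable_bounded_scaleR[OF f A_meas A_bound])
  have "Z *\<^sub>R (\<integral>v. g v *\<^sub>R f v \<partial>\<mu>) = (\<integral>v. (Z * g v - A v) *\<^sub>R f v \<partial>\<mu>)"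
    using int_gf int_Af A_zero by (simp add: scaleR_diff_left flip: scaleR_scaleR)
  also have "norm \<dots> \<le> (e * Z) * (\<integral>v. norm (f v) \<partial>\<mu>)"
    by (rule norm_integral_bounded_scaleR[OF f _ A_close]) (use A_meas in measurable)
  finally have "Z * norm (\<integral>v. g v *\<^sub>R f v \<partial>\<mu>) \<le> Z * (e * (\<integral>v. norm (f v) \<partial>\<mu>))"
    using Z(1) by (simp add: mult_ac)
  then show "norm (\<integral>v. g v *\<^sub>R f v \<partial>\<mu>) \<le> e * (\<integral>v. norm (f v) \<partial>\<mu>)"
    using Z(1) by simp
qed

end

section \<open>Averages over the right action\<close>

context funk_setting
begin

definition right_average :: "(real^'m^('l + 'k) \<Rightarrow> 'c::{banach, second_countable_topology}) \<Rightarrow> real^'m^('l + 'k) \<Rightarrow> 'c" where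
  "right_average f v = (\<integral>\<gamma>. f (v ** \<gamma>) \<partial>\<eta>)"

lemma measurable_orbit_right: "v \<in> stiefel \<Longrightarrow> (\<lambda>\<gamma>. v ** \<gamma>) \<in> \<eta> \<rightarrow>\<^sub>M \<mu>"
  using measurable_restricted_id[OF eta_sets]
  by (auto simp: measurable_restricted_iff[OF mu_sets] eta_space stiefel_mult)

lemma eta_integral_left:
  fixes F :: "_ \<Rightarrow> 'c::{banach, second_countable_topology}"
  assumes "F \<in> borel_measurable \<eta>" "orthogonal_matrix h"
  shows "(\<integral>\<gamma>. F (h ** \<gamma>) \<partial>\<eta>) = (\<integral>\<gamma>. F \<gamma> \<partial>\<eta>)"
proof -
  have "(\<integral>\<gamma>. F \<gamma> \<partial>distr \<eta> \<eta> (\<lambda>\<gamma>. h ** \<gamma>)) = (\<integral>\<gamma>. F (h ** \<gamma>) \<partial>\<eta>)"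
    by (rule integral_distr) (use assms measurable_mult_left[OF eta_sets] in auto)
  then show ?thesis
    by (simp add: invariant_probD(4)[OF eta_stiefel assms(2)])
qed

lemma right_average_invariant:
  fixes f :: "_ \<Rightarrow> 'c::{banach, second_countable_topology}"
  assumes "(\<lambda>\<gamma>. f (v ** \<gamma>)) \<in> borel_measurable \<eta>" "orthogonal_matrix h"
  shows "right_average f (v ** h) = right_average f v"
  using eta_integral_left[OF assms] by (simp add: right_average_def matrix_mul_assoc)

lemma mu_integral_right:
  fixes F :: "_ \<Rightarrow> 'c::{banach, second_countable_topology}"
  assumes "F \<in> borel_measurable \<mu>" "orthogonal_matrix \<gamma>"
  shows "(\<integral>v. F (v ** \<gamma>) \<partial>\<mu>) = (\<integral>v. F v \<partial>\<mu>)"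
proof -
  have "(\<integral>v. F v \<partial>distr \<mu> \<mu> (\<lambda>v. v ** \<gamma>)) = (\<integral>v. F (v ** \<gamma>) \<partial>\<mu>)"
    by (rule integral_distr) (use assms invariant_prob_right[OF mu] in auto)
  then show ?thesis
    by (simp add: invariant_prob_right(2)[OF mu assms(2)])
qed

lemma integrable_mu_eta:
  fixes f :: "_ \<Rightarrow> 'c::{banach, second_countable_topology}"
  assumes "integrable \<mu> f"
  shows "integrable (\<mu> \<Otimes>\<^sub>M \<eta>) (\<lambda>(v, \<gamma>). f (v ** \<gamma>))"
proof -
  have "integrable (distr (\<mu> \<Otimes>\<^sub>M \<eta>) \<mu> (\<lambda>(v, \<gamma>). v ** \<gamma>)) f"
    using assms by (simp add: mu_right)
  from integrable_distr[OF measurable_mu_right this] show ?thesis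
    by (simp add: split_beta')
qed

lemma integrable_right_average:
  fixes f :: "_ \<Rightarrow> 'c::{banach, second_countable_topology}"
  assumes "integrable \<mu> f"
  shows "integrable \<mu> (right_average f)"
  using mu_eta.integrable_fst[OF integrable_mu_eta[OF assms]] by (simp add: right_average_def[abs_def])

lemma integral_right_average:
  fixes f :: "_ \<Rightarrow> 'c::{banach, second_countable_topology}"
  assumes "integrable \<mu> f"
  shows "(\<integral>v. right_average f v \<partial>\<mu>) = (\<integral>v. f v \<partial>\<mu>)"
proof -
  have "(\<integral>v. right_average f v \<partial>\<mu>) = (\<integral>p. (\<lambda>(v, \<gamma>). f (v ** \<gamma>)) p \<partial>(\<mu> \<Otimes>\<^sub>M \<eta>))"
    unfolding right_average_def by (rule mu_eta.integral_fst[OF integrable_mu_eta[OF assms]])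
  also have "\<dots> = (\<integral>v. f v \<partial>distr (\<mu> \<Otimes>\<^sub>M \<eta>) \<mu> (\<lambda>(v, \<gamma>). v ** \<gamma>))"
    by (subst integral_distr[OF measurable_mu_right]) (use assms in \<open>auto simp: split_beta'\<close>)
  finally show ?thesis
    by (simp add: mu_right)
qed

lemma continuous_right_average:
  fixes g :: "real^'m^('l + 'k) \<Rightarrow> real"
  assumes g: "continuous_on UNIV g" and bound: "\<And>v. \<bar>g v\<bar> \<le> 1"
  shows "continuous_on UNIV (right_average g)"
proof -
  note [measurable] = borel_measurable_continuous_onI[OF g] measurable_restricted_id[OF eta_sets]
  have "(\<lambda>n. right_average g (x n)) \<longlonglongrightarrow> right_average g v" if x: "x \<longlonglongrightarrow> v" for x v
    unfolding right_average_def
  proof (rule integral_dominated_convergence[where w = "\<lambda>_. 1"])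
    show "AE \<gamma> in \<eta>. (\<lambda>n. g (x n ** \<gamma>)) \<longlonglongrightarrow> g (v ** \<gamma>)"
    proof (rule AE_I2)
      fix \<gamma>
      have "isCont (\<lambda>w. g (w ** \<gamma>)) v"
        by (rule continuous_on_interior[of UNIV])
          (auto intro!: continuous_on_compose2[OF g] continuous_intros)
      then show "(\<lambda>n. g (x n ** \<gamma>)) \<longlonglongrightarrow> g (v ** \<gamma>)"
        using x by (rule isCont_tendsto_compose)
    qed
  qed (use bound in \<open>auto simp: eta.integrable_const\<close>)
  then show ?thesis
    by (simp add: continuous_on_sequentially comp_def)
qed

text \<open>
  Against a right invariant function the averages of \<open>f\<close> and \<open>f\<close> itself have the same integral, and
  against the right average of \<open>f\<close> a function may be replaced by its own right average.
\<close>

lemma funk_zero_imp_right_average_zero: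
  fixes f :: "real^'m^('l + 'k) \<Rightarrow> complex"
  assumes f: "integrable \<mu> f" and zero: "AE u in \<sigma>. funk \<nu> f u = 0"
    and card: "CARD('m) \<le> CARD('k)"
  shows "AE v in \<mu>. right_average f v = 0"
proof (rule AE_zero_if_orthogonal_to_continuous[OF mu.finite_measure_axioms mu_sets integrable_right_average[OF f]])
  fix g :: "real^'m^('l + 'k) \<Rightarrow> real"
  assume g: "continuous_on UNIV g" and bound: "\<And>v. \<bar>g v\<bar> \<le> 1"
  let ?G = "right_average g"
  note mu_id = measurable_restricted_id[OF mu_sets] and eta_id = measurable_restricted_id[OF eta_sets]
  note [measurable] = mu_id eta_id borel_measurable_continuous_onI[OF g]
  have G: "continuous_on UNIV ?G"
    by (rule continuous_right_average[OF g bound])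
  note [measurable] = borel_measurable_continuous_onI[OF G]
  have G_bound: "\<bar>?G v\<bar> \<le> 1" for v
  proof -
    have "\<bar>?G v\<bar> \<le> (\<integral>\<gamma>. 1 \<partial>\<eta>)"
      unfolding right_average_def
      by (rule integral_abs_bound_integral)
        (use bound in \<open>auto intro!: eta.integrable_const_bound[where B = 1]\<close>)
    then show ?thesis
      by (simp add: eta.prob_space)
  qed
  have G_inv: "?G (v ** \<gamma>) = ?G v" if "orthogonal_matrix \<gamma>" for v \<gamma>
    by (rule right_average_invariant[OF _ that]) measurable
  have f_orbit: "(\<lambda>\<gamma>. f (v ** \<gamma>)) \<in> borel_measurable \<eta>" if "v \<in> stiefel" for v
    using measurable_compose[OF measurable_orbit_right[OF that] borel_measurable_integrable[OF f]] by simp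
  have F: "integrable \<mu> (right_average f)"
    by (rule integrable_right_average[OF f])
  note [measurable] = borel_measurable_integrable[OF F]
  have "(\<integral>v. g v *\<^sub>R right_average f v \<partial>\<mu>) = (\<integral>\<gamma>. (\<integral>v. g v *\<^sub>R right_average f v \<partial>\<mu>) \<partial>\<eta>)"
    by (simp add: eta.prob_space)
  also have "\<dots> = (\<integral>\<gamma>. (\<integral>v. g (v ** \<gamma>) *\<^sub>R right_average f v \<partial>\<mu>) \<partial>\<eta>)"
  proof (rule Bochner_Integration.integral_cong[OF refl])
    fix \<gamma> assume "\<gamma> \<in> space \<eta>"
    then have \<gamma>: "orthogonal_matrix \<gamma>"
      by (simp add: eta_space stiefel_orthogonal)
    have "(\<integral>v. g v *\<^sub>R right_average f v \<partial>\<mu>) = (\<integral>v. g (v ** \<gamma>) *\<^sub>R right_average f (v ** \<gamma>) \<partial>\<mu>)"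
      by (rule mu_integral_right[OF _ \<gamma>, symmetric]) measurable
    also have "\<dots> = (\<integral>v. g (v ** \<gamma>) *\<^sub>R right_average f v \<partial>\<mu>)"
      by (rule Bochner_Integration.integral_cong)
        (auto simp: mu_space right_average_invariant[OF f_orbit \<gamma>])
    finally show "(\<integral>v. g v *\<^sub>R right_average f v \<partial>\<mu>) = (\<integral>v. g (v ** \<gamma>) *\<^sub>R right_average f v \<partial>\<mu>)" .
  qed
  also have "\<dots> = (\<integral>v. ?G v *\<^sub>R right_average f v \<partial>\<mu>)"
    unfolding right_average_def[of g]
  proof (rule integral_bounded_kernel_swap[OF mu.finite_measure_axioms eta.finite_measure_axioms F _ bound])
    have "(\<lambda>p. fst p) \<in> borel_measurable (\<mu> \<Otimes>\<^sub>M \<eta>)" "(\<lambda>p. snd p) \<in> borel_measurable (\<mu> \<Otimes>\<^sub>M \<eta>)"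
      using measurable_compose[OF measurable_fst mu_id] measurable_compose[OF measurable_snd eta_id] by auto
    then show "(\<lambda>(v, \<gamma>). g (v ** \<gamma>)) \<in> borel_measurable (\<mu> \<Otimes>\<^sub>M \<eta>)"
      unfolding split_beta' by measurable
  qed
  also have "\<dots> = (\<integral>v. right_average (\<lambda>v. ?G v *\<^sub>R f v) v \<partial>\<mu>)"
  proof -
    have "right_average (\<lambda>v. ?G v *\<^sub>R f v) v = (\<integral>\<gamma>. ?G v *\<^sub>R f (v ** \<gamma>) \<partial>\<eta>)" for v
      unfolding right_average_def[of "\<lambda>v. ?G v *\<^sub>R f v"]
      by (rule Bochner_Integration.integral_cong) (simp_all add: eta_space stiefel_orthogonal G_inv)
    then show ?thesis
      by (simp add: right_average_def[of f])
  qed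
  also have "\<dots> = (\<integral>v. ?G v *\<^sub>R f v \<partial>\<mu>)"
    by (rule integral_right_average, rule integrable_bounded_scaleR[OF f _ G_bound]) measurable
  also have "\<dots> = 0"
    by (rule funk_zero_right_invariant_test[OF f zero card G G_bound G_inv])
  finally show "(\<integral>v. g v *\<^sub>R right_average f v \<partial>\<mu>) = 0" .
qed

text \<open>
  On a fibre over \<open>u\<close> the right action of \<open>O(m)\<close> preserves the measure, so the integral of \<open>f\<close> over
  the fibre equals that of its right average.  Absolute convergence of the double integral over the
  fibre and \<open>O(m)\<close> holds for almost every \<open>u\<close>, since the right average of \<open>norm \<circ> f\<close> has a finite
  integral over \<open>\<mu>\<close>.
\<close>

lemma right_average_zero_imp_funk_zero:
  fixes f :: "real^'m^('l + 'k) \<Rightarrow> complex"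
  assumes f: "integrable \<mu> f" and zero: "AE v in \<mu>. right_average f v = 0"
  shows "AE u in \<sigma>. funk \<nu> f u = 0"
proof -
  let ?e = "\<lambda>(u, \<omega>). embed (section_of u) \<omega>"
  have e[measurable]: "?e \<in> \<sigma> \<Otimes>\<^sub>M \<nu> \<rightarrow>\<^sub>M \<mu>"
    by (rule measurable_embed_pair) measurable
  note f_meas[measurable] = borel_measurable_integrable[OF f]
  define \<Phi> where "\<Phi> v = (\<integral>\<^sup>+\<gamma>. norm (f (v ** \<gamma>)) \<partial>\<eta>)" for v
  have orbit_meas: "(\<lambda>p. ennreal (norm (f ((\<lambda>(v, \<gamma>). v ** \<gamma>) p)))) \<in> borel_measurable (\<mu> \<Otimes>\<^sub>M \<eta>)"
    by (rule measurable_compose[OF measurable_mu_right]) measurable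
  have \<Phi>[measurable]: "\<Phi> \<in> borel_measurable \<mu>"
    unfolding \<Phi>_def using eta.borel_measurable_nn_integral_fst[OF orbit_meas] by simp
  have "(\<integral>\<^sup>+v. \<Phi> v \<partial>\<mu>) = (\<integral>\<^sup>+p. norm (f ((\<lambda>(v, \<gamma>). v ** \<gamma>) p)) \<partial>(\<mu> \<Otimes>\<^sub>M \<eta>))"
    unfolding \<Phi>_def using eta.nn_integral_fst[OF orbit_meas] by simp
  also have "\<dots> = (\<integral>\<^sup>+v. norm (f v) \<partial>distr (\<mu> \<Otimes>\<^sub>M \<eta>) \<mu> (\<lambda>(v, \<gamma>). v ** \<gamma>))"
    by (rule nn_integral_distr[OF measurable_mu_right, symmetric]) measurable
  also have "\<dots> < \<infinity>"
    using f by (simp add: mu_right integrable_iff_bounded)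
  finally have \<Phi>_finite: "(\<integral>\<^sup>+v. \<Phi> v \<partial>\<mu>) < \<infinity>" .
  have \<Phi>e: "(\<lambda>p. \<Phi> (?e p)) \<in> borel_measurable (\<sigma> \<Otimes>\<^sub>M \<nu>)"
    by measurable
  have "(\<integral>\<^sup>+u. \<integral>\<^sup>+\<omega>. \<Phi> (embed (section_of u) \<omega>) \<partial>\<nu> \<partial>\<sigma>) = (\<integral>\<^sup>+p. \<Phi> (?e p) \<partial>(\<sigma> \<Otimes>\<^sub>M \<nu>))"
    using nu.nn_integral_fst[OF \<Phi>e] by simp
  also have "\<dots> = (\<integral>\<^sup>+v. \<Phi> v \<partial>distr (\<sigma> \<Otimes>\<^sub>M \<nu>) \<mu> ?e)"
    by (rule nn_integral_distr[symmetric]) measurable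
  also have "\<dots> < \<infinity>"
    using \<Phi>_finite by (simp add: sigma_embed)
  finally have "AE u in \<sigma>. (\<integral>\<^sup>+\<omega>. \<Phi> (embed (section_of u) \<omega>) \<partial>\<nu>) \<noteq> \<infinity>"
    using nu.borel_measurable_nn_integral_fst[OF \<Phi>e] by (intro nn_integral_PInf_AE) auto
  moreover have "AE u in \<sigma>. AE \<omega> in \<nu>. right_average f (embed (section_of u) \<omega>) = 0"
  proof -
    have "AE v in distr (\<sigma> \<Otimes>\<^sub>M \<nu>) \<mu> ?e. right_average f v = 0"
      using zero unfolding sigma_embed .
    from sigma_nu.AE_pair[OF AE_distrD[OF e this]] show ?thesis
      by simp
  qed
  ultimately show ?thesis
    using AE_space
  proof eventually_elim
    case (elim u)
    let ?t = "section_of u"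
    have t: "orthogonal_matrix ?t"
      by (rule section_of)
    note te[measurable] = measurable_embed_fiber[OF t]
    have te_mult: "(\<lambda>(\<omega>, \<gamma>). embed ?t \<omega> ** \<gamma>) \<in> \<nu> \<Otimes>\<^sub>M \<eta> \<rightarrow>\<^sub>M \<mu>"
    proof -
      have "(\<lambda>(\<omega>, \<gamma>). (embed ?t \<omega>, \<gamma>)) \<in> \<nu> \<Otimes>\<^sub>M \<eta> \<rightarrow>\<^sub>M \<mu> \<Otimes>\<^sub>M \<eta>"
        by measurable
      from measurable_compose[OF this measurable_mu_right] show ?thesis
        by (simp add: split_beta')
    qed
    have f_te: "(\<lambda>p. f ((\<lambda>(\<omega>, \<gamma>). embed ?t \<omega> ** \<gamma>) p)) \<in> borel_measurable (\<nu> \<Otimes>\<^sub>M \<eta>)"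
      by (rule measurable_compose[OF te_mult f_meas])
    have int: "integrable (\<nu> \<Otimes>\<^sub>M \<eta>) (\<lambda>(\<omega>, \<gamma>). f (embed ?t \<omega> ** \<gamma>))"
    proof (rule integrableI_bounded)
      show "(\<lambda>(\<omega>, \<gamma>). f (embed ?t \<omega> ** \<gamma>)) \<in> borel_measurable (\<nu> \<Otimes>\<^sub>M \<eta>)"
        using f_te by (simp add: split_beta')
      have "(\<lambda>p. ennreal (norm (f ((\<lambda>(\<omega>, \<gamma>). embed ?t \<omega> ** \<gamma>) p)))) \<in> borel_measurable (\<nu> \<Otimes>\<^sub>M \<eta>)"
        using f_te by measurable
      from eta.nn_integral_fst[OF this]
      have "(\<integral>\<^sup>+p. norm (case p of (\<omega>, \<gamma>) \<Rightarrow> f (embed ?t \<omega> ** \<gamma>)) \<partial>(\<nu> \<Otimes>\<^sub>M \<eta>)) = (\<integral>\<^sup>+\<omega>. \<Phi> (embed ?t \<omega>) \<partial>\<nu>)"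
        by (simp add: \<Phi>_def split_beta')
      then show "(\<integral>\<^sup>+p. norm (case p of (\<omega>, \<gamma>) \<Rightarrow> f (embed ?t \<omega> ** \<gamma>)) \<partial>(\<nu> \<Otimes>\<^sub>M \<eta>)) < \<infinity>"
        using elim(1) by (simp add: less_top)
    qed
    have "funk \<nu> f u = (\<integral>\<omega>. f (embed ?t \<omega>) \<partial>\<nu>)"
      using funk_eq[OF f_meas t] section_of(2)[of u] elim(3) by (simp add: sigma_space)
    also have "\<dots> = (\<integral>\<gamma>. (\<integral>\<omega>. f (embed ?t \<omega>) \<partial>\<nu>) \<partial>\<eta>)"
      by (simp add: eta.prob_space)
    also have "\<dots> = (\<integral>\<gamma>. (\<integral>\<omega>. f (embed ?t \<omega> ** \<gamma>) \<partial>\<nu>) \<partial>\<eta>)"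
    proof (rule Bochner_Integration.integral_cong[OF refl])
      fix \<gamma> assume "\<gamma> \<in> space \<eta>"
      then have \<gamma>: "orthogonal_matrix \<gamma>"
        by (simp add: eta_space stiefel_orthogonal)
      have "(\<integral>\<omega>. f (embed ?t \<omega>) \<partial>\<nu>) = (\<integral>\<omega>. f (embed ?t \<omega>) \<partial>distr \<nu> \<nu> (\<lambda>\<omega>. \<omega> ** \<gamma>))"
        by (simp add: invariant_prob_right(2)[OF nu \<gamma>])
      also have "\<dots> = (\<integral>\<omega>. f (embed ?t (\<omega> ** \<gamma>)) \<partial>\<nu>)"
        by (rule integral_distr[OF invariant_prob_right(1)[OF nu \<gamma>]]) measurable
      also have "\<dots> = (\<integral>\<omega>. f (embed ?t \<omega> ** \<gamma>) \<partial>\<nu>)"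
        by (simp add: embed_def matrix_mul_assoc)
      finally show "(\<integral>\<omega>. f (embed ?t \<omega>) \<partial>\<nu>) = (\<integral>\<omega>. f (embed ?t \<omega> ** \<gamma>) \<partial>\<nu>)" .
    qed
    also have "\<dots> = (\<integral>\<omega>. right_average f (embed ?t \<omega>) \<partial>\<nu>)"
      unfolding right_average_def by (rule nu_eta.Fubini_integral[OF int])
    also have "\<dots> = 0"
      by (rule integral_eq_zero_AE) (rule elim(2))
    finally show "funk \<nu> f u = 0" .
  qed
qed

end

theorem theorem1p1:
  fixes \<mu> :: "(real^'m^('l::finite + 'k::finite)) measure"
    and \<sigma> :: "(real^'k^('l::finite + 'k::finite)) measure"
    and \<nu> :: "(real^'m^'l) measure"
    and \<eta> :: "(real^'m^'m) measure"
  assumes "1 \<le> CARD('m)" and "CARD('m) \<le> CARD('k)"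
    and "CARD('k) \<le> CARD('l + 'k) - CARD('m)"
    and "invariant_prob stiefel \<mu>"
    and "invariant_prob stiefel \<sigma>"
    and "invariant_prob stiefel \<nu>"
    and "invariant_prob {\<gamma>. orthogonal_matrix \<gamma>} \<eta>"
  shows "funk_kernel \<mu> \<sigma> \<nu>
           = {f. integrable \<mu> f \<and> (AE v in \<mu>. (\<integral>\<gamma>. f (v ** \<gamma>) \<partial>\<eta>) = 0)}"
proof -
  obtain H :: "(real^('l + 'k)^('l + 'k)) measure" where "right_haar H"
    using right_haar_exists by blast
  then interpret funk_setting \<mu> \<sigma> \<nu> \<eta> H
    using assms(4-7) by unfold_locales
  have "(AE u in \<sigma>. funk \<nu> f u = 0) \<longleftrightarrow> (AE v in \<mu>. right_average f v = 0)" if "integrable \<mu> f" for f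
    using funk_zero_imp_right_average_zero[OF that _ assms(2)] right_average_zero_imp_funk_zero[OF that] by blast
  then show ?thesis
    by (auto simp: funk_kernel_def right_average_def)
qed

end
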